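(* There is an absolute constant $C>0$ such that the following holds. Let $\gamma\in\{0,1\}$, let $f:\mathbb{R}_+\to\mathbb{C}$ be locally absolutely continuous on $\mathbb{R}_+$ with $\lim_{t\to\infty}f(t)=0$, and suppose that $f'\in A_{1,2}$. Then for every $x>0$ $$\widehat{f}_\gamma(x)=\frac{1}{x}\,f\!\left(\frac{\pi}{2x}\right)\sin\frac{\pi\gamma}{2}+\Gamma(x),$$ where the function $\Gamma$ satisfies $\|\Gamma\|_{L^1(\mathbb{R}_+)}\le C\,\|f'\|_{A_{1,2}}$.
   Context: $\mathbb{R}_+=(0,\infty)$. A locally integrable function $g:\mathbb{R}_+\to\mathbb{C}$ belongs to the space $A_{1,2}$ if $$\|g\|_{A_{1,2}}=\sum_{m=-\infty}^{\infty}\left\{\sum_{j=1}^{\infty}\left[\int_{j2^m}^{(j+1)2^m}|g(t)|\,dt\right]^2\right\}^{1/2}<\infty.$$ For $\gamma=0$ or $1$ the (cosine, respectively sine) Fourier transform is $$\widehat{f}_\gamma(x)=\int_0^\infty f(t)\cos\!\left(xt-\frac{\pi\gamma}{2}\right)dt,\qquad x>0,$$ where the integral is understood as an improper integral $\lim_{N\to\infty}\int_0^N$. *)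

theory Defs
  imports "HOL-Analysis.Analysis"
begin

text \<open>Functions on the open half-line are represented by functions on all of \<^typ>\<open>real\<close>;
  nothing below depends on their values at nonpositive arguments.\<close>

text \<open>A finite family of nonoverlapping subintervals of \<open>{a..b}\<close> is a finite set \<open>P\<close> of pairs of
  endpoints whose open intervals are pairwise disjoint.\<close>

definition abs_continuous_on_interval :: "real \<Rightarrow> real \<Rightarrow> (real \<Rightarrow> complex) \<Rightarrow> bool" where
  "abs_continuous_on_interval a b f \<longleftrightarrow>
    (\<forall>\<epsilon>>0. \<exists>\<delta>>0. \<forall>P :: (real \<times> real) set.
       finite P \<and> (\<forall>(u, v)\<in>P. a \<le> u \<and> u < v \<and> v \<le> b) \<and>
       disjoint_family_on (\<lambda>(u, v). {u<..<v}) P \<and> (\<Sum>(u, v)\<in>P. v - u) < \<delta>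
       \<longrightarrow> (\<Sum>(u, v)\<in>P. norm (f v - f u)) < \<epsilon>)"

definition locally_abs_continuous :: "(real \<Rightarrow> complex) \<Rightarrow> bool" where
  "locally_abs_continuous f \<longleftrightarrow>
    (\<forall>a b. 0 < a \<and> a < b \<longrightarrow> abs_continuous_on_interval a b f)"

definition locally_integrable :: "(real \<Rightarrow> complex) \<Rightarrow> bool" where
  "locally_integrable g \<longleftrightarrow>
    (\<forall>a b. 0 < a \<and> a < b \<longrightarrow> set_integrable lebesgue {a..b} g)"

definition dyadic_integral :: "(real \<Rightarrow> complex) \<Rightarrow> int \<Rightarrow> nat \<Rightarrow> real" where
  "dyadic_integral g m j =
    (LINT t:{real j * 2 powi m .. (real j + 1) * 2 powi m}|lebesgue. norm (g t))"

text \<open>The norm is real-valued and meaningful only for elements of \<open>A12\<close>; its finiteness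
  amounts to convergence of each inner series and of the outer series.\<close>

definition A12_norm :: "(real \<Rightarrow> complex) \<Rightarrow> real" where
  "A12_norm g = (\<Sum>\<^sub>\<infinity>m\<in>(UNIV :: int set). sqrt (\<Sum>\<^sub>\<infinity>j\<in>{1..}. (dyadic_integral g m j)\<^sup>2))"

definition A12 :: "(real \<Rightarrow> complex) set" where
  "A12 = {g. locally_integrable g \<and>
     (\<forall>m. (\<lambda>j. (dyadic_integral g m j)\<^sup>2) summable_on {1..}) \<and>
     (\<lambda>m. sqrt (\<Sum>\<^sub>\<infinity>j\<in>{1..}. (dyadic_integral g m j)\<^sup>2)) summable_on (UNIV :: int set)}"

definition truncated_transform :: "nat \<Rightarrow> (real \<Rightarrow> complex) \<Rightarrow> real \<Rightarrow> real \<Rightarrow> complex" where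
  "truncated_transform \<gamma> f x N =
    (LINT t:{0<..N}|lebesgue. f t * complex_of_real (cos (x * t - pi * real \<gamma> / 2)))"

text \<open>The improper integral exists: every truncated integral is a genuine Lebesgue integral,
  and the truncations converge.\<close>

definition fourier_transform_exists :: "nat \<Rightarrow> (real \<Rightarrow> complex) \<Rightarrow> real \<Rightarrow> bool" where
  "fourier_transform_exists \<gamma> f x \<longleftrightarrow>
    (\<forall>N>0. set_integrable lebesgue {0<..N}
        (\<lambda>t. f t * complex_of_real (cos (x * t - pi * real \<gamma> / 2)))) \<and>
    (\<exists>l. (truncated_transform \<gamma> f x \<longlongrightarrow> l) at_top)"

definition fourier_transform :: "nat \<Rightarrow> (real \<Rightarrow> complex) \<Rightarrow> real \<Rightarrow> complex" where
  "fourier_transform \<gamma> f x = Lim at_top (truncated_transform \<gamma> f x)"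

text \<open>\<^const>\<open>vector_derivative\<close> is unspecified where \<open>f\<close> is not differentiable, which
  for locally absolutely continuous \<open>f\<close> is a null set.\<close>

abbreviation derivative :: "(real \<Rightarrow> complex) \<Rightarrow> real \<Rightarrow> complex" where
  "derivative f \<equiv> (\<lambda>t. vector_derivative f (at t))"

end

theory Submission
  imports Defs
begin

text \<open>
  Write \<open>g = f'\<close> and \<open>\<theta> = \<pi>\<gamma>/2\<close>. Since \<open>g\<close> is integrable and \<open>f t = - \<integral>\<^sub>t\<^sup>\<infinity> g\<close>, Fubini gives
  \<open>\<Gamma> x = - (1/x) \<integral> g t w (x t) dt\<close> with \<open>w u = sin (u - \<theta>) + [u < \<pi>/2] sin \<theta>\<close> and \<open>\<bar>w u\<bar> \<le> u\<close>. For \<open>x\<close>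
  in \<open>[1/h, 2/h)\<close>, \<open>h = 2\<^sup>m\<close>, the part with \<open>x t < 2\<close> contributes at most \<open>\<integral> \<bar>g t\<bar> t [x t < 2] dt\<close>, whose
  integral over \<open>x > 0\<close> is \<open>2 \<parallel>g\<parallel>\<^sub>1\<close>; the rest is \<open>1/x\<close> times the sine transform \<open>T\<close> of \<open>g\<close> restricted to
  \<open>[h, \<infinity>)\<close>. By Cauchy-Schwarz it suffices to bound \<open>\<integral> \<bar>T\<bar>\<^sup>2\<close> over that dyadic interval; with the weight \<open>4/h - x\<close>
  on \<open>[0, 4/h]\<close> this is a quadratic form in \<open>g\<close> with kernel at most \<open>16 / (h\<^sup>2 + (s - t)\<^sup>2)\<close>, and a Schur test on
  the blocks \<open>[j h, (j+1) h)\<close> bounds it by the sum of the squares of \<open>\<integral> \<bar>g\<bar>\<close> over the blocks.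

  That \<open>f\<close> is the integral of its derivative is proved by writing \<open>f\<close> as a combination of increasing
  functions whose Stieltjes measures are absolutely continuous, and applying Radon-Nikodym and
  Lebesgue's differentiation theorem.
\<close>

subsection \<open>Dyadic absolute continuity and variation\<close>

text \<open>The norm controls \<open>g\<close> only in \<open>L^1\<close> on each block and in
  \<open>l^2\<close> across blocks, whereas the remainder must be integrated in \<open>x\<close>.
  This forces an \<open>L^2\<close> estimate over one dyadic range of \<open>x\<close> at a time,
  where the square becomes a sum over pairs of blocks. A sharp cut-off in \<open>x\<close> would
  give a kernel decaying like \<open>1 / |s - t|\<close>, whose row sums over blocks diverge
  logarithmically. A weight falling linearly to zero gives a Fejer kernel with quadratic decay; its
  jump at \<open>x = 0\<close> is harmless because against cosines it acts as half of its even
  extension. The transform itself has the weight \<open>sin (u - \<theta>) + sin \<theta>\<close>,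
  which vanishes at \<open>0\<close> but, for the sine transform, does not oscillate about zero for
  large \<open>u\<close>. Extracting the value of \<open>f\<close> at \<open>pi / (2 x)\<close>
  removes the constant for large \<open>u\<close> and leaves a pure sinusoid, to which the
  \<open>L^2\<close> estimate applies. The blocks of level \<open>m\<close> start at
  \<open>j = 1\<close>, that is at \<open>h\<close>, so what lies below \<open>h\<close> has to be
  paid for by the \<open>L^1\<close> norm of \<open>g\<close>. The first blocks of all levels tile
  the half-line, which bounds that norm by the \<open>A12\<close> norm.\<close>

text \<open>Families of cells of a single dyadic level suffice, because every open subset of the positive
  half-line is an increasing union of such families.\<close>

definition dyadic_abs_continuous :: "(real \<Rightarrow> 'a::real_normed_vector) \<Rightarrow> bool" where
  "dyadic_abs_continuous F \<longleftrightarrow>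
    (\<forall>\<epsilon>>0. \<exists>\<delta>>0. \<forall>n (K :: nat set). finite K \<and> real (card K) / 2 ^ n < \<delta> \<longrightarrow>
       (\<Sum>k\<in>K. norm (F (real (Suc k) / 2 ^ n) - F (real k / 2 ^ n))) \<le> \<epsilon>)"

text \<open>Only the cells of \<open>[0, x]\<close> whose right endpoint does not exceed
  \<open>x\<close> are counted, so for each \<open>n\<close> this is a step function of
  \<open>x\<close>; \<open>nat\<close> makes the sum empty for \<open>x \<le> 0\<close>.\<close>

definition dyadic_variation :: "(real \<Rightarrow> 'a::real_normed_vector) \<Rightarrow> nat \<Rightarrow> real \<Rightarrow> real" where
  "dyadic_variation F n x =
    (\<Sum>k<nat \<lfloor>x * 2 ^ n\<rfloor>. norm (F (real (Suc k) / 2 ^ n) - F (real k / 2 ^ n)))"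

text \<open>Refinement makes the sequence increasing and absolute continuity bounds it, so
  \<open>lim\<close> is then a genuine limit. For continuous \<open>F\<close> it is the total
  variation on \<open>[0, x]\<close>.\<close>

definition total_dyadic_variation :: "(real \<Rightarrow> 'a::real_normed_vector) \<Rightarrow> real \<Rightarrow> real" where
  "total_dyadic_variation F x = lim (\<lambda>n. dyadic_variation F n x)"

lemma dyadic_abs_continuousE:
  assumes "dyadic_abs_continuous F" "0 < \<epsilon>"
  obtains \<delta> where "0 < \<delta>" "\<And>n K. finite K \<Longrightarrow> real (card K) / 2 ^ n < \<delta> \<Longrightarrow>
       (\<Sum>k\<in>K. norm (F (real (Suc k) / 2 ^ n) - F (real k / 2 ^ n))) \<le> \<epsilon>"
proof -
  from assms obtain \<delta> where "0 < \<delta>" and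
    \<delta>: "\<forall>n (K :: nat set). finite K \<and> real (card K) / 2 ^ n < \<delta> \<longrightarrow>
       (\<Sum>k\<in>K. norm (F (real (Suc k) / 2 ^ n) - F (real k / 2 ^ n))) \<le> \<epsilon>"
    unfolding dyadic_abs_continuous_def by (elim allE[of _ \<epsilon>] impE exE conjE)
  show thesis
    by (rule that[OF \<open>0 < \<delta>\<close>]) (use \<delta> in simp)
qed

lemma two_power_split: "n \<le> m \<Longrightarrow> (2::real) ^ m = 2 ^ n * 2 ^ (m - n)"
  by (simp add: power_add[symmetric])

lemma dyadic_variation_at_dyadic:
  assumes "n \<le> m"
  shows "dyadic_variation F m (real k / 2 ^ n) =
    (\<Sum>i<k * 2 ^ (m - n). norm (F (real (Suc i) / 2 ^ m) - F (real i / 2 ^ m)))"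
proof -
  have "real k / 2 ^ n * 2 ^ m = real (k * 2 ^ (m - n))"
    unfolding two_power_split[OF assms] by simp
  then have "nat \<lfloor>real k / 2 ^ n * 2 ^ m\<rfloor> = k * 2 ^ (m - n)"
    by (simp only: floor_of_nat nat_int)
  then show ?thesis unfolding dyadic_variation_def by simp
qed

lemma dyadic_variation_mono:
  assumes "x \<le> y"
  shows "dyadic_variation F n x \<le> dyadic_variation F n y"
proof -
  have "nat \<lfloor>x * 2 ^ n\<rfloor> \<le> nat \<lfloor>y * 2 ^ n\<rfloor>"
    using assms by (intro nat_mono floor_mono mult_right_mono) auto
  then show ?thesis
    unfolding dyadic_variation_def by (intro sum_mono2) auto
qed

text \<open>Bisecting a cell cannot lower the sum, by the triangle inequality at the midpoint, and
  \<open>2 * \<lfloor>y\<rfloor> \<le> \<lfloor>2 * y\<rfloor>\<close> keeps both halves of every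
  counted cell inside \<open>[0, x]\<close>.\<close>

lemma dyadic_variation_Suc: "dyadic_variation F n x \<le> dyadic_variation F (Suc n) x"
proof -
  define D where "D = (\<lambda>n k. norm (F (real (Suc k) / 2 ^ n) - F (real k / 2 ^ n)))"
  define N where "N = nat \<lfloor>x * 2 ^ n\<rfloor>"
  have D: "D n k \<le> D (Suc n) (2 * k) + D (Suc n) (Suc (2 * k))" for k
  proof -
    have e1: "real (2 * k) / 2 ^ Suc n = real k / 2 ^ n" by simp
    have e2: "real (Suc (Suc (2 * k))) / 2 ^ Suc n = real (Suc k) / 2 ^ n"
      by (simp add: field_simps)
    show ?thesis unfolding D_def e1 e2
      using norm_triangle_ineq[of "F (real (Suc k) / 2 ^ n) - F (real (Suc (2 * k)) / 2 ^ Suc n)"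
          "F (real (Suc (2 * k)) / 2 ^ Suc n) - F (real k / 2 ^ n)"] by simp
  qed
  have "dyadic_variation F n x = (\<Sum>k<N. D n k)"
    unfolding dyadic_variation_def N_def D_def ..
  also have "\<dots> \<le> (\<Sum>k<N. D (Suc n) (2 * k) + D (Suc n) (Suc (2 * k)))"
    by (intro sum_mono D)
  also have "\<dots> = (\<Sum>k<2 * N. D (Suc n) k)"
    by (induction N) auto
  also have "\<dots> \<le> (\<Sum>k<nat \<lfloor>x * 2 ^ Suc n\<rfloor>. D (Suc n) k)"
  proof (rule sum_mono2)
    have "2 * N \<le> nat \<lfloor>x * 2 ^ Suc n\<rfloor>"
      unfolding N_def by (simp add: le_nat_iff, linarith)
    then show "{..<2 * N} \<subseteq> {..<nat \<lfloor>x * 2 ^ Suc n\<rfloor>}" by auto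
  qed (auto simp: D_def)
  finally show ?thesis unfolding dyadic_variation_def D_def .
qed

lemma dyadic_variation_incseq: "incseq (\<lambda>n. dyadic_variation F n x)"
  by (rule incseq_SucI) (rule dyadic_variation_Suc)

text \<open>Cutting a family of level-\<open>n\<close> cells into cells of level \<open>m\<close>
  keeps its total length: the count grows by \<open>2 ^ (m - n)\<close> and each cell shrinks by
  that factor. A \<open>\<delta>\<close> that admits \<open>K\<close> at level \<open>n\<close>
  therefore admits its refinement at every finer level.\<close>

lemma dyadic_variation_diff_sum:
  assumes "n \<le> m" "finite K"
  shows "(\<Sum>k\<in>K. dyadic_variation F m (real (Suc k) / 2 ^ n) - dyadic_variation F m (real k / 2 ^ n))
      = (\<Sum>i\<in>(\<Union>k\<in>K. {k * 2 ^ (m - n)..<Suc k * 2 ^ (m - n)}).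
          norm (F (real (Suc i) / 2 ^ m) - F (real i / 2 ^ m)))" (is "_ = sum ?D _")
    and "card (\<Union>k\<in>K. {k * 2 ^ (m - n)..<Suc k * 2 ^ (m - n)}) = card K * 2 ^ (m - n)"
proof -
  define p :: nat where "p = 2 ^ (m - n)"
  have p: "p > 0" by (simp add: p_def)
  have disj: "{k * p..<Suc k * p} \<inter> {j * p..<Suc j * p} = {}" if "k \<noteq> j" for k j
  proof -
    have "i div p = k" if "i \<in> {k * p..<Suc k * p}" for i k
      using that p by (intro div_nat_eqI) (auto simp: algebra_simps)
    then show ?thesis using \<open>k \<noteq> j\<close> by blast
  qed
  have "(\<Sum>k\<in>K. dyadic_variation F m (real (Suc k) / 2 ^ n) - dyadic_variation F m (real k / 2 ^ n))
     = (\<Sum>k\<in>K. sum ?D {k * p..<Suc k * p})"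
  proof (rule sum.cong)
    fix k
    have "sum ?D {..<Suc k * p} = sum ?D {..<k * p} + sum ?D {k * p..<Suc k * p}"
      using sum.atLeastLessThan_concat[of 0 "k * p" "Suc k * p" ?D]
      by (simp add: lessThan_atLeast0)
    then show "dyadic_variation F m (real (Suc k) / 2 ^ n) - dyadic_variation F m (real k / 2 ^ n)
       = sum ?D {k * p..<Suc k * p}"
      using dyadic_variation_at_dyadic[OF assms(1), of F k]
        dyadic_variation_at_dyadic[OF assms(1), of F "Suc k"] unfolding p_def by linarith
  qed simp
  also have "\<dots> = sum ?D (\<Union>k\<in>K. {k * p..<Suc k * p})"
    using assms(2) disj by (subst sum.UNION_disjoint) auto
  finally show "(\<Sum>k\<in>K. dyadic_variation F m (real (Suc k) / 2 ^ n) - dyadic_variation F m (real k / 2 ^ n))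
      = sum ?D (\<Union>k\<in>K. {k * 2 ^ (m - n)..<Suc k * 2 ^ (m - n)})"
    unfolding p_def .
  have "card (\<Union>k\<in>K. {k * p..<Suc k * p}) = (\<Sum>k\<in>K. card {k * p..<Suc k * p})"
    using assms(2) disj by (intro card_UN_disjoint) auto
  then show "card (\<Union>k\<in>K. {k * 2 ^ (m - n)..<Suc k * 2 ^ (m - n)}) = card K * 2 ^ (m - n)"
    by (simp add: p_def)
qed

text \<open>A single cell shorter than the \<open>\<delta>\<close> belonging to
  \<open>\<epsilon> = 1\<close> has variation at most \<open>1\<close> at every finer level, and
  finitely many such cells reach \<open>x\<close>.\<close>

lemma dyadic_variation_bounded:
  assumes "dyadic_abs_continuous F"
  shows "\<exists>M. \<forall>n. dyadic_variation F n x \<le> M"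
proof -
  obtain \<delta> where "\<delta> > 0" and \<delta>: "\<And>n K. finite K \<Longrightarrow> real (card K) / 2 ^ n < \<delta> \<Longrightarrow>
       (\<Sum>k\<in>K. norm (F (real (Suc k) / 2 ^ n) - F (real k / 2 ^ n))) \<le> 1"
    using dyadic_abs_continuousE[OF assms zero_less_one] by blast
  obtain n0 where n0: "1 / 2 ^ n0 < \<delta>"
    using real_arch_pow_inv[of \<delta> "1/2"] \<open>\<delta> > 0\<close> by (auto simp: power_divide)
  have step: "dyadic_variation F m (real j / 2 ^ n0) \<le> real j" if "n0 \<le> m" for m j
  proof (induction j)
    case 0
    show ?case by (simp add: dyadic_variation_def)
  next
    case (Suc j)
    have "dyadic_variation F m (real (Suc j) / 2 ^ n0) - dyadic_variation F m (real j / 2 ^ n0) \<le> 1"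
      using dyadic_variation_diff_sum(1)[OF that, of "{j}" F]
        \<delta>[of "{j * 2 ^ (m - n0)..<Suc j * 2 ^ (m - n0)}" m] n0
      by (simp add: two_power_split[OF that])
    with Suc show ?case by simp
  qed
  obtain j :: nat where j: "x * 2 ^ n0 \<le> real j" using real_arch_simple by blast
  then have "x \<le> real j / 2 ^ n0" by (simp add: field_simps)
  then have "dyadic_variation F n x \<le> real j" for n
    using incseqD[OF dyadic_variation_incseq, of n "max n n0" F x] step[of "max n n0" j]
      dyadic_variation_mono[of x "real j / 2 ^ n0" F "max n n0"] by simp
  then show ?thesis by blast
qed

lemma dyadic_variation_tendsto:
  assumes "dyadic_abs_continuous F"
  shows "(\<lambda>n. dyadic_variation F n x) \<longlonglongrightarrow> total_dyadic_variation F x"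
proof -
  obtain M where "\<And>n. dyadic_variation F n x \<le> M"
    using dyadic_variation_bounded[OF assms] by blast
  then have "convergent (\<lambda>n. dyadic_variation F n x)"
    using incseq_convergent[OF dyadic_variation_incseq] by (metis convergentI)
  then show ?thesis unfolding total_dyadic_variation_def by (simp add: convergent_LIMSEQ_iff)
qed

text \<open>Between grid points the increment telescopes over cells. A positive \<open>x\<close> is
  replaced by the largest grid point \<open>q n x\<close> not above it; in general
  \<open>q n x\<close> tends to \<open>max x 0\<close>, so continuity recovers \<open>F x\<close>
  and constancy on the nonpositive axis handles \<open>x \<le> 0\<close>.\<close>

lemma total_dyadic_variation_diff_ge:
  assumes F: "dyadic_abs_continuous F" and cont: "continuous_on UNIV F"
    and const: "\<And>x. x \<le> 0 \<Longrightarrow> F x = F 0" and "x \<le> y"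
  shows "norm (F y - F x) \<le> total_dyadic_variation F y - total_dyadic_variation F x"
proof -
  define q where "q = (\<lambda>n (x::real). real (nat \<lfloor>x * 2 ^ n\<rfloor>) / 2 ^ n)"
  have q: "(\<lambda>n. F (q n x)) \<longlonglongrightarrow> F x" for x
  proof -
    have "(\<lambda>n. q n x) \<longlonglongrightarrow> max x 0"
    proof (rule tendsto_sandwich)
      have "max x 0 - (1/2) ^ n \<le> q n x \<and> q n x \<le> max x 0" for n
      proof (cases "x \<le> 0")
        case True
        then have "x * 2 ^ n \<le> 0" by (simp add: mult_nonpos_nonneg)
        then have "nat \<lfloor>x * 2 ^ n\<rfloor> = 0" by linarith
        then show ?thesis using True by (simp add: q_def max_def)
      next
        case False
        then have "0 \<le> x * 2 ^ n" by simp
        then have "x * 2 ^ n - 1 \<le> real (nat \<lfloor>x * 2 ^ n\<rfloor>)" "real (nat \<lfloor>x * 2 ^ n\<rfloor>) \<le> x * 2 ^ n"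
          by linarith+
        then have "(x * 2 ^ n - 1) / 2 ^ n \<le> q n x" "q n x \<le> x * 2 ^ n / 2 ^ n"
          unfolding q_def by (intro divide_right_mono; simp)+
        then show ?thesis using False by (simp add: max_def diff_divide_distrib power_divide)
      qed
      then show "\<forall>\<^sub>F n in sequentially. max x 0 - (1/2) ^ n \<le> q n x"
        "\<forall>\<^sub>F n in sequentially. q n x \<le> max x 0" by auto
      show "(\<lambda>n. max x 0 - (1/2) ^ n) \<longlonglongrightarrow> max x 0"
        using tendsto_diff[OF tendsto_const LIMSEQ_realpow_zero[of "1/2"]] by simp
    qed simp
    then have "(\<lambda>n. F (q n x)) \<longlonglongrightarrow> F (max x 0)"
      using cont by (intro isCont_tendsto_compose[of _ F]) (auto simp: continuous_on_eq_continuous_at)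
    then show ?thesis using const[of x] by (cases "x \<le> 0") (auto simp: max_def)
  qed
  have "norm (F (q n y) - F (q n x)) \<le> dyadic_variation F n y - dyadic_variation F n x" for n
  proof -
    define d where "d = (\<lambda>k. F (real (Suc k) / 2 ^ n) - F (real k / 2 ^ n))"
    let ?N = "\<lambda>x. nat \<lfloor>x * 2 ^ n\<rfloor>"
    have le: "?N x \<le> ?N y" using \<open>x \<le> y\<close> by (auto intro!: nat_mono floor_mono mult_right_mono)
    have "F (q n y) - F (q n x) = sum d {?N x..<?N y}"
      unfolding d_def q_def using sum_Suc_diff'[OF le, of "\<lambda>k. F (real k / 2 ^ n)"] by simp
    then have "norm (F (q n y) - F (q n x)) \<le> (\<Sum>k\<in>{?N x..<?N y}. norm (d k))"
      by (simp add: norm_sum)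
    also have "\<dots> = (\<Sum>k<?N y. norm (d k)) - (\<Sum>k<?N x. norm (d k))"
      using sum.atLeastLessThan_concat[of 0 "?N x" "?N y" "\<lambda>k. norm (d k)"] le
      by (simp add: lessThan_atLeast0)
    finally show ?thesis unfolding dyadic_variation_def d_def .
  qed
  then show ?thesis
    using dyadic_variation_tendsto[OF F] q
    by (intro LIMSEQ_le[OF tendsto_norm[OF tendsto_diff[OF q[of y] q[of x]]]
          tendsto_diff[OF dyadic_variation_tendsto[OF F, of y] dyadic_variation_tendsto[OF F, of x]]]) auto
qed

text \<open>The \<open>\<delta>\<close> of \<open>F\<close> serves its variation as well: the bound
  holds at every level \<open>m \<ge> n\<close> and, being nonstrict in
  \<open>dyadic_abs_continuous\<close>, survives the limit in \<open>m\<close>.\<close>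

lemma dyadic_abs_continuous_total_variation:
  assumes F: "dyadic_abs_continuous F"
  shows "dyadic_abs_continuous (total_dyadic_variation F)"
  unfolding dyadic_abs_continuous_def
proof (intro allI impI)
  fix \<epsilon> :: real assume "\<epsilon> > 0"
  then obtain \<delta> where "\<delta> > 0" and \<delta>: "\<And>n K. finite K \<Longrightarrow> real (card K) / 2 ^ n < \<delta> \<Longrightarrow>
       (\<Sum>k\<in>K. norm (F (real (Suc k) / 2 ^ n) - F (real k / 2 ^ n))) \<le> \<epsilon>"
    using dyadic_abs_continuousE[OF F] by blast
  show "\<exists>\<delta>>0. \<forall>n (K :: nat set). finite K \<and> real (card K) / 2 ^ n < \<delta> \<longrightarrow>
       (\<Sum>k\<in>K. norm (total_dyadic_variation F (real (Suc k) / 2 ^ n) - total_dyadic_variation F (real k / 2 ^ n))) \<le> \<epsilon>"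
  proof (intro exI[of _ \<delta>] conjI allI impI \<open>\<delta> > 0\<close>, elim conjE)
    fix n and K :: "nat set" assume K: "finite K" "real (card K) / 2 ^ n < \<delta>"
    have le: "real k / 2 ^ n \<le> real (Suc k) / 2 ^ n" for k by (simp add: field_simps)
    have "(\<Sum>k\<in>K. norm (dyadic_variation F m (real (Suc k) / 2 ^ n) - dyadic_variation F m (real k / 2 ^ n))) \<le> \<epsilon>"
      (is "?v m \<le> \<epsilon>") if "n \<le> m" for m
    proof -
      have "real (card K * 2 ^ (m - n)) / 2 ^ m < \<delta>"
        using K(2) by (simp add: two_power_split[OF that])
      then show ?thesis
        using \<delta>[of "\<Union>k\<in>K. {k * 2 ^ (m - n)..<Suc k * 2 ^ (m - n)}" m]
          dyadic_variation_diff_sum(1)[OF that K(1), of F] dyadic_variation_diff_sum(2)[OF that K(1)] K(1)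
        by (simp add: abs_of_nonneg dyadic_variation_mono[OF le] del: of_nat_Suc mult_Suc)
    qed
    then have "\<exists>N. \<forall>m\<ge>N. ?v m \<le> \<epsilon>" by blast
    moreover have "(\<lambda>m. \<Sum>k\<in>K. norm (dyadic_variation F m (real (Suc k) / 2 ^ n) - dyadic_variation F m (real k / 2 ^ n)))
      \<longlonglongrightarrow> (\<Sum>k\<in>K. norm (total_dyadic_variation F (real (Suc k) / 2 ^ n) - total_dyadic_variation F (real k / 2 ^ n)))"
      by (intro tendsto_sum tendsto_norm tendsto_diff dyadic_variation_tendsto[OF F])
    ultimately show "(\<Sum>k\<in>K. norm (total_dyadic_variation F (real (Suc k) / 2 ^ n) - total_dyadic_variation F (real k / 2 ^ n))) \<le> \<epsilon>"
      by (rule LIMSEQ_le_const2[rotated])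
  qed
qed

lemma dyadic_abs_continuous_add:
  assumes F: "dyadic_abs_continuous F" and G: "dyadic_abs_continuous G"
  shows "dyadic_abs_continuous (\<lambda>x. F x + G x)"
  unfolding dyadic_abs_continuous_def
proof (intro allI impI)
  fix \<epsilon> :: real assume "\<epsilon> > 0"
  then have "\<epsilon> / 2 > 0" by simp
  then obtain \<delta>1 where "\<delta>1 > 0" and \<delta>1: "\<And>n K. finite K \<Longrightarrow> real (card K) / 2 ^ n < \<delta>1 \<Longrightarrow>
       (\<Sum>k\<in>K. norm (F (real (Suc k) / 2 ^ n) - F (real k / 2 ^ n))) \<le> \<epsilon> / 2"
    using dyadic_abs_continuousE[OF F] by blast
  obtain \<delta>2 where "\<delta>2 > 0" and \<delta>2: "\<And>n K. finite K \<Longrightarrow> real (card K) / 2 ^ n < \<delta>2 \<Longrightarrow>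
       (\<Sum>k\<in>K. norm (G (real (Suc k) / 2 ^ n) - G (real k / 2 ^ n))) \<le> \<epsilon> / 2"
    using dyadic_abs_continuousE[OF G \<open>\<epsilon> / 2 > 0\<close>] by blast
  show "\<exists>\<delta>>0. \<forall>n (K :: nat set). finite K \<and> real (card K) / 2 ^ n < \<delta> \<longrightarrow>
       (\<Sum>k\<in>K. norm (F (real (Suc k) / 2 ^ n) + G (real (Suc k) / 2 ^ n) - (F (real k / 2 ^ n) + G (real k / 2 ^ n)))) \<le> \<epsilon>"
  proof (intro exI[of _ "min \<delta>1 \<delta>2"] conjI allI impI)
    fix n and K :: "nat set" assume K: "finite K \<and> real (card K) / 2 ^ n < min \<delta>1 \<delta>2"
    have "(\<Sum>k\<in>K. norm (F (real (Suc k) / 2 ^ n) + G (real (Suc k) / 2 ^ n) - (F (real k / 2 ^ n) + G (real k / 2 ^ n))))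
      \<le> (\<Sum>k\<in>K. norm (F (real (Suc k) / 2 ^ n) - F (real k / 2 ^ n)) + norm (G (real (Suc k) / 2 ^ n) - G (real k / 2 ^ n)))"
      by (intro sum_mono norm_diff_triangle_ineq)
    also have "\<dots> \<le> \<epsilon>"
      using \<delta>1[of K n] \<delta>2[of K n] K by (simp add: sum.distrib)
    finally show "(\<Sum>k\<in>K. norm (F (real (Suc k) / 2 ^ n) + G (real (Suc k) / 2 ^ n) - (F (real k / 2 ^ n) + G (real k / 2 ^ n)))) \<le> \<epsilon>" .
  qed (use \<open>\<delta>1 > 0\<close> \<open>\<delta>2 > 0\<close> in auto)
qed

lemma dyadic_abs_continuous_dominated:
  assumes F: "dyadic_abs_continuous F" and le: "\<And>x y. norm (G x - G y) \<le> norm (F x - F y)"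
  shows "dyadic_abs_continuous G"
proof -
  show ?thesis
    unfolding dyadic_abs_continuous_def
  proof (intro allI impI)
    fix \<epsilon> :: real assume "\<epsilon> > 0"
    then obtain \<delta> where \<delta>: "0 < \<delta>" "\<And>n K. finite K \<Longrightarrow> real (card K) / 2 ^ n < \<delta> \<Longrightarrow>
       (\<Sum>k\<in>K. norm (F (real (Suc k) / 2 ^ n) - F (real k / 2 ^ n))) \<le> \<epsilon>"
      using dyadic_abs_continuousE[OF F] by blast
    show "\<exists>\<delta>>0. \<forall>n (K :: nat set). finite K \<and> real (card K) / 2 ^ n < \<delta> \<longrightarrow>
       (\<Sum>k\<in>K. norm (G (real (Suc k) / 2 ^ n) - G (real k / 2 ^ n))) \<le> \<epsilon>"
      by (intro exI[of _ \<delta>] conjI allI impI \<delta>(1), elim conjE, rule order_trans[OF sum_mono[OF le] \<delta>(2)])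
  qed
qed

subsection \<open>Densities of monotone absolutely continuous functions\<close>

text \<open>Near a point, a monotone function is squeezed between its values at the two ends of the
  three surrounding cells, whose combined increment is small; hence the level with cells shorter
  than \<open>\<delta> / 3\<close>.\<close>

lemma dyadic_abs_continuous_mono_continuous:
  fixes G :: "real \<Rightarrow> real"
  assumes G: "dyadic_abs_continuous G" and "mono G" and const: "\<And>x. x \<le> 0 \<Longrightarrow> G x = G 0"
  shows "continuous_on UNIV G"
proof -
  have mono: "G x \<le> G y" if "x \<le> y" for x y using monoD[OF \<open>mono G\<close> that] .
  have "\<exists>d>0. \<forall>y. dist y x < d \<longrightarrow> dist (G y) (G x) < \<epsilon>" if "\<epsilon> > 0" for x \<epsilon>
  proof -
    have "\<epsilon> / 2 > 0" using that by simp
    from dyadic_abs_continuousE[OF G this] obtain \<delta> where "0 < \<delta>"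
      and \<delta>: "\<And>n K. finite K \<Longrightarrow> real (card K) / 2 ^ n < \<delta> \<Longrightarrow>
       (\<Sum>k\<in>K. norm (G (real (Suc k) / 2 ^ n) - G (real k / 2 ^ n))) \<le> \<epsilon> / 2" by blast
    obtain n where n: "1 / 2 ^ n < \<delta> / 3"
      using real_arch_pow_inv[of "\<delta> / 3" "1/2"] \<open>\<delta> > 0\<close> by (auto simp: power_divide)
    define k where "k = nat \<lfloor>x * 2 ^ n\<rfloor>"
    \<comment> \<open>For \<open>k = 0\<close> the truncated subtraction puts \<open>lo\<close> at
      \<open>0\<close>. Points to the left of \<open>0\<close> are then covered by constancy, which
      is why \<open>max y 0\<close> appears below.\<close>
    define lo where "lo = real (k - 1) / 2 ^ n"
    define hi where "hi = real (k + 2) / 2 ^ n"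
    have near: "G lo \<le> G y \<and> G y \<le> G hi" if y: "\<bar>y - x\<bar> < 1 / 2 ^ n" for y
    proof -
      have xk: "x * 2 ^ n < real k + 1" unfolding k_def by linarith
      have y2: "\<bar>y * 2 ^ n - x * 2 ^ n\<bar> < 1"
        using mult_strict_right_mono[OF y, of "2 ^ n"]
        by (simp add: left_diff_distrib[symmetric] abs_mult)
      then have "y * 2 ^ n \<le> real (k + 2)" using xk by simp
      then have "y \<le> hi" unfolding hi_def by (simp add: field_simps)
      moreover have "lo \<le> max y 0"
      proof (cases "k = 0")
        case True
        then show ?thesis by (simp add: lo_def)
      next
        case False
        then have "real k \<le> x * 2 ^ n" unfolding k_def by linarith
        then have "real (k - 1) \<le> y * 2 ^ n" using y2 False by (simp add: of_nat_diff)
        then have "lo \<le> y" unfolding lo_def by (simp add: field_simps)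
        then show ?thesis by simp
      qed
      then have "G lo \<le> G (max y 0)" by (rule mono)
      moreover have "G (max y 0) = G y" using const[of y] by (cases "y \<le> 0") (auto simp: max_def)
      ultimately show ?thesis using mono by simp
    qed
    have "G hi - G lo = (\<Sum>i\<in>{k - 1..<k + 2}. G (real (Suc i) / 2 ^ n) - G (real i / 2 ^ n))"
      unfolding hi_def lo_def by (subst sum_Suc_diff') auto
    also have "\<dots> \<le> (\<Sum>i\<in>{k - 1..<k + 2}. norm (G (real (Suc i) / 2 ^ n) - G (real i / 2 ^ n)))"
      by (intro sum_mono) simp
    also have "\<dots> \<le> \<epsilon> / 2"
    proof (rule \<delta>)
      have "real (card {k - 1..<k + 2}) \<le> 3" by simp
      then have "real (card {k - 1..<k + 2}) / 2 ^ n \<le> 3 / 2 ^ n"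
        by (rule divide_right_mono) simp
      then show "real (card {k - 1..<k + 2}) / 2 ^ n < \<delta>"
        using n by simp
    qed simp
    finally have "G hi - G lo \<le> \<epsilon> / 2" .
    then have "\<forall>y. dist y x < 1 / 2 ^ n \<longrightarrow> dist (G y) (G x) < \<epsilon>"
      using near[of x] near \<open>\<epsilon> > 0\<close> by (fastforce simp: dist_real_def abs_less_iff)
    then show ?thesis by (intro exI[of _ "1 / 2 ^ n"]) simp
  qed
  then show ?thesis unfolding continuous_on_iff by auto
qed

text \<open>Regularity encloses \<open>N\<close> in an open set of Lebesgue measure below
  \<open>\<delta>\<close>. The selected cells inside it have Stieltjes measure at most
  \<open>\<epsilon>\<close> at each level, and continuity from below carries this to their union.
  The nonpositive axis has measure \<open>0\<close> because \<open>G\<close> is constant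
  there.\<close>

lemma interval_measure_null_if_abs_continuous:
  fixes G :: "real \<Rightarrow> real"
  assumes G: "dyadic_abs_continuous G" and "mono G" and const: "\<And>x. x \<le> 0 \<Longrightarrow> G x = G 0"
    and N: "N \<in> null_sets lborel"
  shows "emeasure (interval_measure G) N = 0"
proof -
  have mono: "G x \<le> G y" if "x \<le> y" for x y using monoD[OF \<open>mono G\<close> that] .
  have "continuous_on UNIV G"
    by (rule dyadic_abs_continuous_mono_continuous[OF G \<open>mono G\<close> const])
  then have rc: "continuous (at_right x) G" for x
    by (simp add: continuous_on_eq_continuous_at continuous_at_imp_continuous_within)
  note Ioc = emeasure_interval_measure_Ioc[OF _ mono rc]
  have N_sets [measurable]: "N \<in> sets borel" using N by auto
  have neg: "emeasure (interval_measure G) {..0} = 0"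
  proof -
    have "emeasure (interval_measure G) (\<Union>n::nat. {- real n<..0}) = 0"
    proof (rule emeasure_UN_eq_0)
      show "emeasure (interval_measure G) {- real n<..0} = 0" for n
        using Ioc[of "- real n" 0] const[of "- real n"] by simp
    qed auto
    moreover have "(\<Union>n::nat. {- real n<..0}) = {..0}"
      using reals_Archimedean2 by (auto, metis minus_less_iff)
    ultimately show ?thesis by simp
  qed
  have "emeasure (interval_measure G) N \<le> ennreal \<epsilon>" if "\<epsilon> > 0" for \<epsilon>
  proof -
    from dyadic_abs_continuousE[OF G \<open>\<epsilon> > 0\<close>] obtain \<delta> where "0 < \<delta>"
      and \<delta>: "\<And>n K. finite K \<Longrightarrow> real (card K) / 2 ^ n < \<delta> \<Longrightarrow>
       (\<Sum>k\<in>K. norm (G (real (Suc k) / 2 ^ n) - G (real k / 2 ^ n))) \<le> \<epsilon>" by blast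
    obtain U where U: "open U" "N \<subseteq> U" "emeasure lborel (U - N) < ennreal \<delta>"
      using outer_regular_lborel[OF N_sets \<open>0 < \<delta>\<close>] .
    have U_sets [measurable]: "U \<in> sets borel" using U(1) by simp
    have "emeasure lborel U < ennreal \<delta>"
      using U(3) emeasure_Diff_null_set[OF N, of U] by simp
    define cell where "cell = (\<lambda>n k. {real k / 2 ^ n<..real (Suc k) / 2 ^ n})"
    define C where "C = (\<lambda>n. {k. k < 4 ^ n \<and> cell n k \<subseteq> U})"
    define A where "A = (\<lambda>n. \<Union>k\<in>C n. cell n k)"
    have fin: "finite (C n)" for n unfolding C_def by simp
    have disj: "disjoint_family_on (cell n) K" for n K
    proof -
      have "k = j" if "x \<in> cell n k" "x \<in> cell n j" for x k j
      proof -
        have "real k < x * 2 ^ n" "x * 2 ^ n \<le> real k + 1" "real j < x * 2 ^ n" "x * 2 ^ n \<le> real j + 1"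
          using that by (auto simp: cell_def field_simps)
        then show ?thesis by linarith
      qed
      then show ?thesis unfolding disjoint_family_on_def by blast
    qed
    have bound: "emeasure (interval_measure G) (A n) \<le> ennreal \<epsilon>" for n
    proof -
      have le: "real k / 2 ^ n \<le> real (Suc k) / 2 ^ n" for k by (simp add: field_simps)
      have "emeasure lborel (A n) = (\<Sum>k\<in>C n. emeasure lborel (cell n k))"
        unfolding A_def by (subst sum_emeasure[OF _ disj fin]) (auto simp: cell_def)
      also have "\<dots> = (\<Sum>k\<in>C n. ennreal (1 / 2 ^ n))"
        unfolding cell_def
        by (intro sum.cong refl) (subst emeasure_lborel_Ioc[OF le], simp add: diff_divide_distrib[symmetric])
      also have "\<dots> = ennreal (real (card (C n)) / 2 ^ n)"
        by (subst sum_ennreal) auto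
      finally have "ennreal (real (card (C n)) / 2 ^ n) \<le> emeasure lborel U"
        using emeasure_mono[of "A n" U lborel] by (auto simp: A_def C_def)
      then have "ennreal (real (card (C n)) / 2 ^ n) < ennreal \<delta>"
        using \<open>emeasure lborel U < ennreal \<delta>\<close> by (rule le_less_trans)
      then have "real (card (C n)) / 2 ^ n < \<delta>"
        using \<open>0 < \<delta>\<close> by (simp add: ennreal_less_iff)
      from \<delta>[OF fin this] have *: "(\<Sum>k\<in>C n. norm (G (real (Suc k) / 2 ^ n) - G (real k / 2 ^ n))) \<le> \<epsilon>" .
      have "emeasure (interval_measure G) (A n) = (\<Sum>k\<in>C n. emeasure (interval_measure G) (cell n k))"
        unfolding A_def by (subst sum_emeasure[OF _ disj fin]) (auto simp: cell_def)
      also have "\<dots> = (\<Sum>k\<in>C n. ennreal (norm (G (real (Suc k) / 2 ^ n) - G (real k / 2 ^ n))))"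
        unfolding cell_def using mono[OF le] by (intro sum.cong refl) (simp add: Ioc[OF le] del: of_nat_Suc)
      also have "\<dots> = ennreal (\<Sum>k\<in>C n. norm (G (real (Suc k) / 2 ^ n) - G (real k / 2 ^ n)))"
        by (rule sum_ennreal) simp
      also have "\<dots> \<le> ennreal \<epsilon>" using * by (rule ennreal_leI)
      finally show ?thesis .
    qed
    have inc: "incseq A"
    proof (rule incseq_SucI, rule subsetI)
      fix n x assume "x \<in> A n"
      then obtain k where k: "k < 4 ^ n" "cell n k \<subseteq> U" "x \<in> cell n k"
        unfolding A_def C_def by auto
      \<comment> \<open>The half of cell \<open>k\<close> that contains \<open>x\<close>; the
        midpoint goes to the left half because cells are closed on the right.\<close>
      define j where "j = (if x \<le> real (Suc (2 * k)) / 2 ^ Suc n then 2 * k else Suc (2 * k))"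
      have "cell (Suc n) j \<subseteq> cell n k" "x \<in> cell (Suc n) j"
        using k(3) unfolding cell_def j_def by (auto simp: field_simps split: if_splits)
      moreover have "j < 4 ^ Suc n" using k(1) unfolding j_def by auto
      ultimately show "x \<in> A (Suc n)" using k(2) unfolding A_def C_def by auto
    qed
    have cover: "U \<inter> {0<..} \<subseteq> (\<Union>n. A n)"
    proof
      fix x assume x: "x \<in> U \<inter> {0<..}"
      then obtain r where "r > 0" and r: "ball x r \<subseteq> U"
        using U(1) openE by blast
      obtain n1 where n1: "1 / 2 ^ n1 < r"
        using real_arch_pow_inv[of r "1/2"] \<open>r > 0\<close> by (auto simp: power_divide)
      obtain n2 where n2: "x < 2 ^ n2"
        using real_arch_pow[of 2 x] by auto
      define n where "n = max n1 n2"
      have n: "1 / 2 ^ n < r" "x < 2 ^ n"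
      proof -
        have "(1::real) / 2 ^ n \<le> 1 / 2 ^ n1" unfolding n_def by (simp add: field_simps)
        then show "1 / 2 ^ n < r" using n1 by (rule le_less_trans)
        have "(2::real) ^ n2 \<le> 2 ^ n" unfolding n_def by simp
        with n2 show "x < 2 ^ n" by (rule less_le_trans)
      qed
      \<comment> \<open>Ceiling minus one rather than floor, because cells are open on the
        left.\<close>
      define k where "k = nat (\<lceil>x * 2 ^ n\<rceil> - 1)"
      have pos: "0 < x * 2 ^ n" using x by simp
      then have k1: "real k < x * 2 ^ n" "x * 2 ^ n \<le> real k + 1"
        unfolding k_def by linarith+
      have "x * 2 ^ n < 2 ^ n * 2 ^ n" using n(2) by simp
      then have "real k < 2 ^ n * 2 ^ n" using k1(1) by linarith
      also have "(2::real) ^ n * 2 ^ n = real (4 ^ n)"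
        by (simp add: power_mult_distrib[symmetric])
      finally have "k < 4 ^ n" by (simp only: of_nat_less_iff)
      moreover have xk: "x \<in> cell n k" using k1 unfolding cell_def by (auto simp: field_simps)
      moreover have "cell n k \<subseteq> ball x r"
      proof
        fix y assume y: "y \<in> cell n k"
        have "\<bar>x - y\<bar> \<le> real (Suc k) / 2 ^ n - real k / 2 ^ n"
          using xk y unfolding cell_def by auto
        also have "\<dots> = 1 / 2 ^ n" by (simp add: diff_divide_distrib[symmetric])
        finally show "y \<in> ball x r" using n(1) by (simp add: dist_real_def)
      qed
      ultimately show "x \<in> (\<Union>n. A n)" using r unfolding A_def C_def by blast
    qed
    have A_sets: "A n \<in> sets borel" for n
      unfolding A_def cell_def using fin by (intro sets.finite_UN) auto
    have "emeasure (interval_measure G) (\<Union>n. A n) = (SUP n. emeasure (interval_measure G) (A n))"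
      using inc A_sets by (intro SUP_emeasure_incseq[symmetric]) auto
    also have "\<dots> \<le> ennreal \<epsilon>" by (rule SUP_least) (rule bound)
    finally have "emeasure (interval_measure G) (\<Union>n. A n) \<le> ennreal \<epsilon>" .
    moreover have "emeasure (interval_measure G) N \<le> emeasure (interval_measure G) ({..0} \<union> (\<Union>n. A n))"
      using cover U(2) A_sets by (intro emeasure_mono) (auto simp: not_le)
    moreover have "\<dots> \<le> emeasure (interval_measure G) {..0} + emeasure (interval_measure G) (\<Union>n. A n)"
      using A_sets by (intro emeasure_subadditive) auto
    ultimately show ?thesis using neg by simp
  qed
  then have "emeasure (interval_measure G) N \<le> 0 + ennreal \<epsilon>" if "\<epsilon> > 0" for \<epsilon>
    using that by simp
  then have "emeasure (interval_measure G) N \<le> 0"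
    by (rule ennreal_le_epsilon)
  then show ?thesis by simp
qed

lemma mono_abs_continuous_density:
  fixes G :: "real \<Rightarrow> real"
  assumes G: "dyadic_abs_continuous G" and "mono G" and const: "\<And>x. x \<le> 0 \<Longrightarrow> G x = G 0"
  obtains g where "\<And>x y. x \<le> y \<Longrightarrow> (g has_integral (G y - G x)) {x..y}"
proof -
  have mono: "G x \<le> G y" if "x \<le> y" for x y using monoD[OF \<open>mono G\<close> that] .
  have cont: "continuous_on UNIV G"
    by (rule dyadic_abs_continuous_mono_continuous[OF G \<open>mono G\<close> const])
  have "absolutely_continuous lborel (interval_measure G)"
    unfolding absolutely_continuous_def
  proof
    fix N assume "N \<in> null_sets (lborel :: real measure)"
    then show "N \<in> null_sets (interval_measure G)"
      using interval_measure_null_if_abs_continuous[OF G \<open>mono G\<close> const] by (auto simp: null_sets_def)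
  qed
  then obtain h where h: "h \<in> borel_measurable lborel" "density lborel h = interval_measure G"
    using sigma_finite_measure.Radon_Nikodym[OF sigma_finite_lborel, of "interval_measure G"] by auto
  have [measurable]: "h \<in> borel_measurable borel" using h(1) by simp
  have int: "(\<integral>\<^sup>+t. h t * indicator {x..y} t \<partial>lborel) = ennreal (G y - G x)" if "x \<le> y" for x y
    using emeasure_interval_measure_Icc[OF that mono cont] h(2) emeasure_density[OF h(1), of "{x..y}"] by simp
  \<comment> \<open>The Radon-Nikodym density takes values in \<open>ennreal\<close>. Its integral
    over a bounded interval is an increment of \<open>G\<close>, so it is finite almost everywhere
    and \<open>enn2real\<close> loses nothing but a null set.\<close>
  have "AE t in lborel. h t * indicator {- real n..real n} t \<noteq> \<infinity>" for n
    using int[of "- real n" "real n"] by (intro nn_integral_PInf_AE) auto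
  then have "AE t in lborel. \<forall>n. h t * indicator {- real n..real n} t \<noteq> \<infinity>"
    by (simp add: AE_all_countable)
  then have fin: "AE t in lborel. h t \<noteq> \<infinity>"
  proof eventually_elim
    case (elim t)
    obtain n where "\<bar>t\<bar> < real n" using reals_Archimedean2 by blast
    then show ?case using elim[rule_format, of n] by (simp add: indicator_def abs_less_iff split: if_splits)
  qed
  define g where "g = (\<lambda>t. enn2real (h t))"
  have "(g has_integral (G y - G x)) {x..y}" if "x \<le> y" for x y
  proof -
    have "(\<integral>\<^sup>+t. ennreal (g t * indicator {x..y} t) \<partial>lborel) = (\<integral>\<^sup>+t. h t * indicator {x..y} t \<partial>lborel)"
      using fin by (intro nn_integral_cong_AE, eventually_elim)
        (auto simp: g_def indicator_def less_top)
    then have "((\<lambda>t. g t * indicator {x..y} t) has_integral (G y - G x)) UNIV"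
      using int[OF that] mono[OF that]
      by (intro nn_integral_has_integral) (auto simp: g_def)
    moreover have "(\<lambda>t. g t * indicator {x..y} t) = (\<lambda>t. if t \<in> {x..y} then g t else 0)"
      by (auto simp: indicator_def)
    ultimately show ?thesis by (simp only: has_integral_restrict_UNIV)
  qed
  then show ?thesis by (rule that)
qed

subsection \<open>The fundamental theorem for absolutely continuous functions\<close>

text \<open>Jordan decomposition: with \<open>p\<close> either \<open>Re\<close> or
  \<open>Im\<close>, both \<open>V\<close> and \<open>V + p F\<close> are increasing, since the
  increments of \<open>p F\<close> are dominated by those of \<open>V\<close>. The density of
  \<open>p F\<close> is the difference of the two densities.\<close>

lemma abs_continuous_has_density:
  fixes F :: "real \<Rightarrow> complex"
  assumes F: "dyadic_abs_continuous F" and cont: "continuous_on UNIV F"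
    and const: "\<And>x. x \<le> 0 \<Longrightarrow> F x = F 0"
  obtains g where "\<And>x y. x \<le> y \<Longrightarrow> (g has_integral (F y - F x)) {x..y}"
proof -
  define V where "V = total_dyadic_variation F"
  have V: "dyadic_abs_continuous V"
    unfolding V_def by (rule dyadic_abs_continuous_total_variation[OF F])
  have diff: "norm (F y - F x) \<le> V y - V x" if "x \<le> y" for x y
    unfolding V_def by (rule total_dyadic_variation_diff_ge[OF F cont const that])
  have V0: "V x = V 0" if "x \<le> 0" for x
  proof -
    have "dyadic_variation F n x = 0" for n
    proof -
      have "x * 2 ^ n \<le> 0" using that by (simp add: mult_nonpos_nonneg)
      then have "nat \<lfloor>x * 2 ^ n\<rfloor> = 0" by linarith
      then show ?thesis by (simp add: dyadic_variation_def)
    qed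
    then show ?thesis by (simp add: V_def total_dyadic_variation_def dyadic_variation_def)
  qed
  have density: "\<exists>g. \<forall>x y. x \<le> y \<longrightarrow> (g has_integral (p (F y) - p (F x))) {x..y}"
    if p: "p = Re \<or> p = Im" for p :: "complex \<Rightarrow> real"
  proof -
    have p_le: "\<bar>p (F y) - p (F x)\<bar> \<le> norm (F y - F x)" for x y
      using p abs_Re_le_cmod[of "F y - F x"] abs_Im_le_cmod[of "F y - F x"] by auto
    have "dyadic_abs_continuous (\<lambda>x. p (F x))"
      using p_le by (intro dyadic_abs_continuous_dominated[OF F]) simp
    then have "dyadic_abs_continuous (\<lambda>x. V x + p (F x))"
      by (rule dyadic_abs_continuous_add[OF V])
    moreover have "mono (\<lambda>x. V x + p (F x))"
    proof (rule monoI)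
      fix x y :: real assume "x \<le> y"
      then show "V x + p (F x) \<le> V y + p (F y)" using diff[of x y] p_le[of y x] by linarith
    qed
    moreover have "V x + p (F x) = V 0 + p (F 0)" if "x \<le> 0" for x
      using V0[OF that] const[OF that] by simp
    ultimately obtain g1 where
      g1: "\<And>x y. x \<le> y \<Longrightarrow> (g1 has_integral (V y + p (F y) - (V x + p (F x)))) {x..y}"
      using mono_abs_continuous_density[of "\<lambda>x. V x + p (F x)"] by blast
    have "mono V"
    proof (rule monoI)
      fix x y :: real assume "x \<le> y"
      then show "V x \<le> V y" using diff[of x y] norm_ge_zero[of "F y - F x"] by linarith
    qed
    then obtain g2 where g2: "\<And>x y. x \<le> y \<Longrightarrow> (g2 has_integral (V y - V x)) {x..y}"
      using mono_abs_continuous_density[OF V] V0 by blast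
    have "((\<lambda>t. g1 t - g2 t) has_integral (p (F y) - p (F x))) {x..y}" if "x \<le> y" for x y
      using has_integral_diff[OF g1[OF that] g2[OF that]] by (simp add: algebra_simps)
    then show ?thesis by blast
  qed
  obtain g1 where g1: "\<And>x y. x \<le> y \<Longrightarrow> (g1 has_integral (Re (F y) - Re (F x))) {x..y}"
    using density[of Re] by blast
  obtain g2 where g2: "\<And>x y. x \<le> y \<Longrightarrow> (g2 has_integral (Im (F y) - Im (F x))) {x..y}"
    using density[of Im] by blast
  have "((\<lambda>t. complex_of_real (g1 t) + \<i> * complex_of_real (g2 t)) has_integral (F y - F x)) {x..y}"
    if "x \<le> y" for x y
  proof -
    have "((\<lambda>t. complex_of_real (g1 t)) has_integral complex_of_real (Re (F y) - Re (F x))) {x..y}"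
      using g1[OF that] by (rule has_integral_of_real)
    moreover have "((\<lambda>t. complex_of_real (g2 t)) has_integral complex_of_real (Im (F y) - Im (F x))) {x..y}"
      using g2[OF that] by (rule has_integral_of_real)
    ultimately have "((\<lambda>t. complex_of_real (g1 t) + \<i> * complex_of_real (g2 t)) has_integral
        (complex_of_real (Re (F y) - Re (F x)) + \<i> * complex_of_real (Im (F y) - Im (F x)))) {x..y}"
      by (intro has_integral_add has_integral_mult_right)
    moreover have "complex_of_real (Re (F y) - Re (F x)) + \<i> * complex_of_real (Im (F y) - Im (F x)) = F y - F x"
      by (simp add: complex_eq_iff)
    ultimately show ?thesis by simp
  qed
  then show ?thesis by (rule that)
qed

text \<open>\<open>integrable_ccontinuous_explicit\<close> averages over boxes that have
  \<open>x\<close> as their lower corner, so it yields the derivative from the right only.\<close>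

lemma indefinite_integral_right_derivative:
  fixes F :: "real \<Rightarrow> complex"
  assumes "\<And>x y. x \<le> y \<Longrightarrow> (g has_integral (F y - F x)) {x..y}"
  obtains N where "negligible N"
    "\<And>x e. x \<notin> N \<Longrightarrow> 0 < e \<Longrightarrow> \<exists>d>0. \<forall>h. 0 < h \<and> h < d \<longrightarrow> norm (F (x + h) - F x - h *\<^sub>R g x) \<le> e * h"
proof -
  have "g integrable_on cbox a b" for a b :: real
  proof (cases "a \<le> b")
    case True
    then show ?thesis using assms by (auto simp: integrable_on_def)
  qed (simp add: integrable_on_empty)
  from integrable_ccontinuous_explicit[OF this] obtain N where N: "negligible N" and
    *: "\<And>x e. x \<notin> N \<Longrightarrow> 0 < e \<Longrightarrow> \<exists>d>0. \<forall>h. 0 < h \<and> h < d \<longrightarrow>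
        norm (integral (cbox x (x + h *\<^sub>R One)) g /\<^sub>R h ^ DIM(real) - g x) < e"
    by blast
  show ?thesis
  proof (rule that[OF N])
    fix x e :: real assume "x \<notin> N" "0 < e"
    then obtain d where "d > 0" and
      d: "\<forall>h. 0 < h \<and> h < d \<longrightarrow> norm (integral (cbox x (x + h *\<^sub>R One)) g /\<^sub>R h ^ DIM(real) - g x) < e"
      using * by blast
    have "norm (F (x + h) - F x - h *\<^sub>R g x) \<le> e * h" if "0 < h" "h < d" for h
    proof -
      have "integral {x..x + h} g = F (x + h) - F x"
        using assms[of x "x + h"] that by (simp add: integral_unique)
      then have "norm ((F (x + h) - F x) /\<^sub>R h - g x) < e"
        using d that by auto
      then have "h * norm ((F (x + h) - F x) /\<^sub>R h - g x) \<le> h * e"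
        using that by simp
      also have "h * norm ((F (x + h) - F x) /\<^sub>R h - g x) = norm (h *\<^sub>R ((F (x + h) - F x) /\<^sub>R h - g x))"
        using that by simp
      also have "h *\<^sub>R ((F (x + h) - F x) /\<^sub>R h - g x) = F (x + h) - F x - h *\<^sub>R g x"
        using that by (simp add: scaleR_diff_right)
      finally show ?thesis by (simp add: mult.commute)
    qed
    then show "\<exists>d>0. \<forall>h. 0 < h \<and> h < d \<longrightarrow> norm (F (x + h) - F x - h *\<^sub>R g x) \<le> e * h"
      using \<open>d > 0\<close> by blast
  qed
qed

text \<open>The left derivative of \<open>F\<close> at \<open>x\<close> is the right derivative at
  \<open>- x\<close> of \<open>- F (- t)\<close>, which has density \<open>g (- t)\<close>. The
  exceptional set of the reflected function has to be reflected back.\<close>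

lemma indefinite_integral_vector_derivative:
  fixes F :: "real \<Rightarrow> complex"
  assumes int: "\<And>x y. x \<le> y \<Longrightarrow> (g has_integral (F y - F x)) {x..y}"
  obtains N where "negligible N" "\<And>x. x \<notin> N \<Longrightarrow> (F has_vector_derivative g x) (at x)"
proof -
  obtain N1 where N1: "negligible N1"
    "\<And>x e. x \<notin> N1 \<Longrightarrow> 0 < e \<Longrightarrow> \<exists>d>0. \<forall>h. 0 < h \<and> h < d \<longrightarrow> norm (F (x + h) - F x - h *\<^sub>R g x) \<le> e * h"
    using indefinite_integral_right_derivative[of g F, OF int] by blast
  have "((\<lambda>t. g (- t)) has_integral ((- F (- y)) - (- F (- x)))) {x..y}" if "x \<le> y" for x y
    using has_integral_reflect_lemma_real[OF int[of "- y" "- x"]] that by simp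
  then obtain N2 where N2: "negligible N2"
    "\<And>x e. x \<notin> N2 \<Longrightarrow> 0 < e \<Longrightarrow> \<exists>d>0. \<forall>h. 0 < h \<and> h < d \<longrightarrow>
        norm (- F (- (x + h)) - - F (- x) - h *\<^sub>R g (- x)) \<le> e * h"
    using indefinite_integral_right_derivative[of "\<lambda>t. g (- t)" "\<lambda>t. - F (- t)"] by blast
  show ?thesis
  proof (rule that)
    have "negligible (uminus ` N2)"
      by (intro negligible_differentiable_image_negligible N2(1))
        (auto intro: derivative_intros)
    then show "negligible (N1 \<union> uminus ` N2)"
      using N1(1) by simp
    fix x assume "x \<notin> N1 \<union> uminus ` N2"
    then have x: "x \<notin> N1" "- x \<notin> N2" by (auto simp: image_iff)
    show "(F has_vector_derivative g x) (at x)"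
      unfolding has_vector_derivative_def has_derivative_at_alt
    proof (intro conjI allI impI)
      fix e :: real assume "e > 0"
      obtain d1 where d1: "d1 > 0" "\<And>h. 0 < h \<Longrightarrow> h < d1 \<Longrightarrow> norm (F (x + h) - F x - h *\<^sub>R g x) \<le> e * h"
        using N1(2)[OF x(1) \<open>e > 0\<close>] by blast
      obtain d2 where d2: "d2 > 0" "\<And>h. 0 < h \<Longrightarrow> h < d2 \<Longrightarrow> norm (- F (- (- x + h)) - - F (- (- x)) - h *\<^sub>R g (- (- x))) \<le> e * h"
        using N2(2)[OF x(2) \<open>e > 0\<close>] by blast
      have "norm (F y - F x - (y - x) *\<^sub>R g x) \<le> e * norm (y - x)" if y: "norm (y - x) < min d1 d2" for y
      proof -
        consider "y = x" | "y > x" | "y < x" by linarith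
        then show ?thesis
        proof cases
          case 2
          then show ?thesis using d1(2)[of "y - x"] y by simp
        next
          case 3
          have "- F y + F x - (x - y) *\<^sub>R g x = F x - F y - (x - y) *\<^sub>R g x" by simp
          also have "\<dots> = - (F y - F x - (y - x) *\<^sub>R g x)" by (simp add: algebra_simps)
          finally have "norm (- F y + F x - (x - y) *\<^sub>R g x) = norm (F y - F x - (y - x) *\<^sub>R g x)"
            by (metis norm_minus_cancel)
          then show ?thesis using d2(2)[of "x - y"] y 3 by simp
        qed simp
      qed
      then show "\<exists>d>0. \<forall>y. norm (y - x) < d \<longrightarrow> norm (F y - F x - (y - x) *\<^sub>R g x) \<le> e * norm (y - x)"
        using d1(1) d2(1) by (intro exI[of _ "min d1 d2"]) auto
    qed (simp add: bounded_linear_scaleR_left)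
  qed
qed

text \<open>Clamping the argument to \<open>[a, b]\<close> extends \<open>f\<close> by constants to
  the whole line, and \<open>0 < a\<close> gives constancy on the nonpositive axis. Clamping does
  not increase distances, so dyadic cells become nonoverlapping subintervals of no greater total
  length.\<close>

lemma abs_continuous_on_interval_clamp:
  assumes f: "abs_continuous_on_interval a b f" and "0 < a" "a < b"
  defines "F \<equiv> \<lambda>x. f (max a (min b x))"
  shows "dyadic_abs_continuous F" and "continuous_on UNIV F" and "\<And>x. x \<le> 0 \<Longrightarrow> F x = F 0"
proof -
  define c where "c = (\<lambda>x. max a (min b x))"
  have c_mono: "c x \<le> c y" if "x \<le> y" for x y using that unfolding c_def by auto
  have c_range: "a \<le> c x" "c x \<le> b" for x using \<open>a < b\<close> unfolding c_def by auto
  have c_diff: "c y - c x \<le> y - x" if "x \<le> y" for x y using that unfolding c_def by auto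
  have fE: "\<exists>\<delta>>0. \<forall>P :: (real \<times> real) set.
       finite P \<and> (\<forall>(u, v)\<in>P. a \<le> u \<and> u < v \<and> v \<le> b) \<and>
       disjoint_family_on (\<lambda>(u, v). {u<..<v}) P \<and> (\<Sum>(u, v)\<in>P. v - u) < \<delta>
       \<longrightarrow> (\<Sum>(u, v)\<in>P. norm (f v - f u)) < \<epsilon>" if "\<epsilon> > 0" for \<epsilon>
    using f that unfolding abs_continuous_on_interval_def by simp
  show "dyadic_abs_continuous F"
    unfolding dyadic_abs_continuous_def
  proof (intro allI impI)
    fix \<epsilon> :: real assume "\<epsilon> > 0"
    then obtain \<delta> where "\<delta> > 0" and \<delta>: "\<forall>P :: (real \<times> real) set.
       finite P \<and> (\<forall>(u, v)\<in>P. a \<le> u \<and> u < v \<and> v \<le> b) \<and>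
       disjoint_family_on (\<lambda>(u, v). {u<..<v}) P \<and> (\<Sum>(u, v)\<in>P. v - u) < \<delta>
       \<longrightarrow> (\<Sum>(u, v)\<in>P. norm (f v - f u)) < \<epsilon>"
      using fE[OF \<open>\<epsilon> > 0\<close>] by (elim exE conjE)
    have "(\<Sum>k\<in>K. norm (F (real (Suc k) / 2 ^ n) - F (real k / 2 ^ n))) \<le> \<epsilon>"
      if K: "finite K" "real (card K) / 2 ^ n < \<delta>" for n and K :: "nat set"
    proof -
      define u where "u = (\<lambda>k::nat. c (real k / 2 ^ n))"
      \<comment> \<open>Cells collapsed by the clamp contribute \<open>0\<close> and are discarded:
        a family \<open>P\<close> admits only nondegenerate intervals, and distinct surviving cells
        then give distinct pairs.\<close>
      define J where "J = {k \<in> K. u k < u (Suc k)}"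
      define P where "P = (\<lambda>k. (u k, u (Suc k))) ` J"
      have "finite J" unfolding J_def using K(1) by simp
      have u_mono: "u j \<le> u k" if "j \<le> k" for j k
        unfolding u_def using that by (intro c_mono divide_right_mono) auto
      have inj: "inj_on (\<lambda>k. (u k, u (Suc k))) J"
      proof (rule linorder_inj_onI)
        fix j k assume "j < k" "j \<in> J" "k \<in> J"
        then show "(u j, u (Suc j)) \<noteq> (u k, u (Suc k))"
          using u_mono[of "Suc j" k] by (auto simp: J_def)
      qed auto
      have disj: "disjoint_family_on (\<lambda>(u, v). {u<..<v}) P"
        unfolding disjoint_family_on_def
      proof (intro ballI impI)
        fix p q assume "p \<in> P" "q \<in> P" "p \<noteq> q"
        then obtain j k where jk: "p = (u j, u (Suc j))" "q = (u k, u (Suc k))" "j \<noteq> k"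
          unfolding P_def by auto
        then have "u (Suc j) \<le> u k \<or> u (Suc k) \<le> u j"
          using u_mono[of "Suc j" k] u_mono[of "Suc k" j] by linarith
        then show "(case p of (u, v) \<Rightarrow> {u<..<v}) \<inter> (case q of (u, v) \<Rightarrow> {u<..<v}) = {}"
          unfolding jk by auto
      qed
      have "(\<Sum>(u, v)\<in>P. v - u) = (\<Sum>k\<in>J. u (Suc k) - u k)"
        unfolding P_def by (simp add: sum.reindex[OF inj] o_def)
      also have "\<dots> \<le> (\<Sum>k\<in>J. 1 / 2 ^ n)"
      proof (rule sum_mono)
        fix k
        have "u (Suc k) - u k \<le> real (Suc k) / 2 ^ n - real k / 2 ^ n"
          unfolding u_def by (rule c_diff) (simp add: divide_right_mono)
        then show "u (Suc k) - u k \<le> 1 / 2 ^ n" by (simp add: diff_divide_distrib[symmetric])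
      qed
      also have "\<dots> \<le> (\<Sum>k\<in>K. 1 / 2 ^ n)"
        using K(1) by (intro sum_mono2) (auto simp: J_def)
      also have "\<dots> < \<delta>" using K(2) by simp
      finally have small: "(\<Sum>(u, v)\<in>P. v - u) < \<delta>" .
      have "(\<Sum>k\<in>K. norm (F (real (Suc k) / 2 ^ n) - F (real k / 2 ^ n))) = (\<Sum>k\<in>K. norm (f (u (Suc k)) - f (u k)))"
        unfolding F_def u_def c_def ..
      also have "\<dots> = (\<Sum>k\<in>J. norm (f (u (Suc k)) - f (u k)))"
      proof (rule sum.mono_neutral_right)
        show "\<forall>k\<in>K - J. norm (f (u (Suc k)) - f (u k)) = 0"
        proof
          fix k assume "k \<in> K - J"
          then have "u (Suc k) = u k" using u_mono[of k "Suc k"] unfolding J_def by simp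
          then show "norm (f (u (Suc k)) - f (u k)) = 0" by simp
        qed
      qed (use K(1) in \<open>auto simp: J_def\<close>)
      also have "\<dots> = (\<Sum>(u, v)\<in>P. norm (f v - f u))"
        unfolding P_def by (simp add: sum.reindex[OF inj] o_def)
      also have "\<dots> < \<epsilon>"
      proof (rule \<delta>[rule_format], intro conjI)
        show "finite P" unfolding P_def using \<open>finite J\<close> by simp
        show "\<forall>(u, v)\<in>P. a \<le> u \<and> u < v \<and> v \<le> b"
          using c_range by (auto simp: P_def J_def u_def)
      qed (fact disj small)+
      finally show ?thesis by simp
    qed
    then show "\<exists>\<delta>>0. \<forall>n (K :: nat set). finite K \<and> real (card K) / 2 ^ n < \<delta> \<longrightarrow>
       (\<Sum>k\<in>K. norm (F (real (Suc k) / 2 ^ n) - F (real k / 2 ^ n))) \<le> \<epsilon>"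
      using \<open>\<delta> > 0\<close> by (intro exI[of _ \<delta>]) auto
  qed
  show "continuous_on UNIV F"
    unfolding continuous_on_iff
  proof (intro ballI allI impI)
    fix x \<epsilon> :: real assume "\<epsilon> > 0"
    then obtain \<delta> where "\<delta> > 0" and \<delta>: "\<forall>P :: (real \<times> real) set.
       finite P \<and> (\<forall>(u, v)\<in>P. a \<le> u \<and> u < v \<and> v \<le> b) \<and>
       disjoint_family_on (\<lambda>(u, v). {u<..<v}) P \<and> (\<Sum>(u, v)\<in>P. v - u) < \<delta>
       \<longrightarrow> (\<Sum>(u, v)\<in>P. norm (f v - f u)) < \<epsilon>"
      using fE[OF \<open>\<epsilon> > 0\<close>] by (elim exE conjE)
    have near: "norm (f (c v) - f (c u)) < \<epsilon>" if "u \<le> v" "v - u < \<delta>" for u v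
    proof (cases "c u < c v")
      case True
      then show ?thesis
        using \<delta>[rule_format, of "{(c u, c v)}"] c_range c_diff[OF that(1)] that(2)
        by (simp add: disjoint_family_on_def)
    next
      case False
      then have "c u = c v" using c_mono[OF that(1)] by simp
      then show ?thesis using \<open>\<epsilon> > 0\<close> by simp
    qed
    have "dist (F y) (F x) < \<epsilon>" if "dist y x < \<delta>" for y
      using near[of x y] near[of y x] that
      by (cases "x \<le> y") (auto simp: F_def c_def dist_norm norm_minus_commute)
    then show "\<exists>d>0. \<forall>y\<in>UNIV. dist y x < d \<longrightarrow> dist (F y) (F x) < \<epsilon>"
      using \<open>\<delta> > 0\<close> by blast
  qed
  show "F x = F 0" if "x \<le> 0" for x
    unfolding F_def using that \<open>0 < a\<close> \<open>a < b\<close> by (simp add: max_def min_def)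
qed

lemma locally_abs_continuous_has_integral:
  assumes f: "locally_abs_continuous f" and "0 < x" "x \<le> y"
  shows "(derivative f has_integral (f y - f x)) {x..y}"
proof -
  \<comment> \<open>The interval \<open>[x / 2, y + 1]\<close> contains \<open>[x, y]\<close> in its
    interior, so the clamped function agrees with \<open>f\<close> near every point of
    \<open>[x, y]\<close>, endpoints included, and has the same derivative there.\<close>
  have "0 < x / 2" "x / 2 < y + 1" using assms(2,3) by auto
  then have ac: "abs_continuous_on_interval (x / 2) (y + 1) f"
    using f unfolding locally_abs_continuous_def by blast
  define F where "F = (\<lambda>t. f (max (x / 2) (min (y + 1) t)))"
  have F: "dyadic_abs_continuous F" "continuous_on UNIV F" "\<And>t. t \<le> 0 \<Longrightarrow> F t = F 0"
    using abs_continuous_on_interval_clamp[OF ac \<open>0 < x / 2\<close> \<open>x / 2 < y + 1\<close>] unfolding F_def .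
  obtain g where g: "\<And>u v. u \<le> v \<Longrightarrow> (g has_integral (F v - F u)) {u..v}"
    using abs_continuous_has_density[OF F] by blast
  obtain N where N: "negligible N" "\<And>t. t \<notin> N \<Longrightarrow> (F has_vector_derivative g t) (at t)"
    using indefinite_integral_vector_derivative[of g F, OF g] by blast
  have "derivative f t = g t" if "t \<in> {x..y} - N" for t
  proof -
    have eq: "F s = f s" if "s \<in> {x / 2<..<y + 1}" for s
      using that unfolding F_def by (simp add: max_def min_def)
    have "(f has_vector_derivative g t) (at t)"
    proof (rule has_vector_derivative_transform_within_open[of F])
      show "(F has_vector_derivative g t) (at t)" using N(2) that by simp
      show "t \<in> {x / 2<..<y + 1}" using that \<open>0 < x\<close> by auto
    qed (use eq in auto)
    then show ?thesis by (rule vector_derivative_at)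
  qed
  moreover have "(g has_integral (f y - f x)) {x..y}"
    using g[OF \<open>x \<le> y\<close>] \<open>0 < x\<close> \<open>x \<le> y\<close> by (simp add: F_def max_def min_def)
  ultimately show ?thesis
    using N(1) by (intro has_integral_spike[of N "{x..y}" "derivative f" g]) auto
qed

subsection \<open>A weighted square estimate for sine transforms\<close>

text \<open>One integration by parts produces the Fejer kernel
  \<open>(1 - cos (a * A)) / a\<^sup>2\<close>; the value at \<open>a = 0\<close> is its
  limit.\<close>

lemma fejer_weight_cos_integral:
  fixes A a :: real
  assumes "0 \<le> A"
  shows "has_bochner_integral lborel (\<lambda>x. ((A - x) * cos (a * x)) * indicator {0..A} x)
    (if a = 0 then A\<^sup>2 / 2 else (1 - cos (a * A)) / a\<^sup>2)"
proof -
  let ?F = "\<lambda>x. if a = 0 then A * x - x\<^sup>2 / 2 else (A - x) * sin (a * x) / a - cos (a * x) / a\<^sup>2"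
  have "has_bochner_integral lborel (\<lambda>x. indicator {0..A} x *\<^sub>R ((A - x) * cos (a * x))) (?F A - ?F 0)"
  proof (rule has_bochner_integral_FTC_Icc[OF assms])
    fix x :: real
    show "(?F has_vector_derivative (A - x) * cos (a * x)) (at x within {0..A})"
    proof (cases "a = 0")
      case True
      then show ?thesis
        unfolding has_real_derivative_iff_has_vector_derivative[symmetric]
        by (auto intro!: derivative_eq_intros)
    next
      case False
      then show ?thesis
        unfolding has_real_derivative_iff_has_vector_derivative[symmetric]
        by (auto intro!: derivative_eq_intros simp: field_simps power2_eq_square)
    qed
  qed (intro continuous_intros)
  then show ?thesis by (auto simp: mult.commute power2_eq_square diff_divide_distrib)
qed

lemma one_minus_cos_le: "1 - cos y \<le> y\<^sup>2 / 2" for y :: real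
proof -
  have "cos y = 1 - 2 * (sin (y / 2))\<^sup>2"
    using cos_double_sin[of "y / 2"] by simp
  moreover have "(sin (y / 2))\<^sup>2 \<le> (y / 2)\<^sup>2"
    using abs_sin_x_le_abs_x[of "y / 2"] by (simp only: abs_le_square_iff)
  ultimately show ?thesis by (simp add: power2_eq_square)
qed

text \<open>The bound \<open>1 - cos y \<le> y\<^sup>2 / 2\<close> yields
  \<open>8 / h\<^sup>2\<close> for \<open>\<bar>a\<bar> \<le> h\<close>, and
  \<open>1 - cos y \<le> 2\<close> yields \<open>2 / a\<^sup>2\<close> beyond. Both are at most
  \<open>16 / (h\<^sup>2 + a\<^sup>2)\<close>, because the larger of \<open>h\<^sup>2\<close> and
  \<open>a\<^sup>2\<close> is at least half of their sum.\<close>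

lemma fejer_weight_cos_bound:
  fixes h a :: real
  assumes h: "0 < h"
  shows "\<bar>\<integral>x. ((4 / h - x) * cos (a * x)) * indicator {0..4 / h} x \<partial>lborel\<bar> \<le> 16 / (h\<^sup>2 + a\<^sup>2)"
proof -
  have "(\<integral>x. ((4 / h - x) * cos (a * x)) * indicator {0..4 / h} x \<partial>lborel)
      = (if a = 0 then (4 / h)\<^sup>2 / 2 else (1 - cos (a * (4 / h))) / a\<^sup>2)"
    using fejer_weight_cos_integral[of "4 / h" a] h by (simp add: has_bochner_integral_integral_eq)
  moreover have "\<bar>(if a = 0 then (4 / h)\<^sup>2 / 2 else (1 - cos (a * (4 / h))) / a\<^sup>2)\<bar> \<le> 16 / (h\<^sup>2 + a\<^sup>2)"
  proof (cases "a = 0")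
    case True
    then show ?thesis by (simp add: power_divide divide_right_mono)
  next
    case False
    have nn: "0 \<le> 1 - cos (a * (4 / h))" by simp
    show ?thesis
    proof (cases "\<bar>a\<bar> \<le> h")
      case True
      have "1 - cos (a * (4 / h)) \<le> (a * (4 / h))\<^sup>2 / 2"
        by (rule one_minus_cos_le)
      then have "(1 - cos (a * (4 / h))) / a\<^sup>2 \<le> ((a * (4 / h))\<^sup>2 / 2) / a\<^sup>2"
        by (rule divide_right_mono) simp
      also have "\<dots> = 8 / h\<^sup>2" using False h by (simp add: field_simps power2_eq_square)
      also have "\<dots> \<le> 16 / (h\<^sup>2 + a\<^sup>2)"
      proof -
        have "a\<^sup>2 \<le> h\<^sup>2" using True h by (simp add: abs_le_square_iff[symmetric])
        then have "8 * (h\<^sup>2 + a\<^sup>2) \<le> 16 * h\<^sup>2" by simp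
        moreover have "0 < h\<^sup>2 + a\<^sup>2" using h by (simp add: add_pos_nonneg)
        ultimately show ?thesis using h by (simp add: divide_le_eq le_divide_eq)
      qed
      finally show ?thesis using False nn by simp
    next
      case False2: False
      have "(1 - cos (a * (4 / h))) / a\<^sup>2 \<le> 2 / a\<^sup>2"
        by (rule divide_right_mono) (use cos_ge_minus_one[of "a * (4 / h)"] in auto)
      also have "\<dots> \<le> 16 / (h\<^sup>2 + a\<^sup>2)"
      proof -
        have "h\<^sup>2 \<le> a\<^sup>2" using False2 h by (simp add: abs_le_square_iff[symmetric])
        then have "2 * (h\<^sup>2 + a\<^sup>2) \<le> 16 * a\<^sup>2" by (simp add: order_trans[of "h\<^sup>2" "a\<^sup>2" "7 * a\<^sup>2"])
        moreover have "0 < h\<^sup>2 + a\<^sup>2" using h by (simp add: add_pos_nonneg)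
        ultimately show ?thesis using False by (simp add: divide_le_eq le_divide_eq)
      qed
      finally show ?thesis using False nn by simp
    qed
  qed
  ultimately show ?thesis by simp
qed

text \<open>The product is half the difference of \<open>cos ((s - t) * x)\<close> and
  \<open>cos ((s + t) * x - 2 * \<theta>)\<close>. The condition
  \<open>sin (2 * \<theta>) = 0\<close> turns the second into a multiple of a cosine; a sine against
  this weight would decay only like \<open>1 / (s + t)\<close>. For nonnegative \<open>s\<close> and
  \<open>t\<close> the kernel at \<open>s + t\<close> is dominated by the one at
  \<open>s - t\<close>.\<close>

lemma fejer_weight_sin_sin_bound:
  fixes h s t \<theta> :: real
  assumes h: "0 < h" and "0 \<le> s" "0 \<le> t" and \<theta>: "sin (2 * \<theta>) = 0"
  shows "\<bar>\<integral>x. ((4 / h - x) * indicator {0..4 / h} x) * (sin (x * s - \<theta>) * sin (x * t - \<theta>)) \<partial>lborel\<bar>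
    \<le> 16 / (h\<^sup>2 + (s - t)\<^sup>2)"
proof -
  let ?K = "\<lambda>a. \<integral>x. ((4 / h - x) * cos (a * x)) * indicator {0..4 / h} x \<partial>lborel"
  have int: "integrable lborel (\<lambda>x. ((4 / h - x) * cos (a * x)) * indicator {0..4 / h} x)" for a
    using fejer_weight_cos_integral[of "4 / h" a] h by (auto simp: has_bochner_integral_iff)
  have sc: "sin (x * s - \<theta>) * sin (x * t - \<theta>) = cos ((s - t) * x) / 2 - cos (2 * \<theta>) * cos ((s + t) * x) / 2" for x
  proof -
    have "cos ((x * s - \<theta>) + (x * t - \<theta>)) = cos ((s + t) * x - 2 * \<theta>)" by (simp add: algebra_simps)
    also have "\<dots> = cos (2 * \<theta>) * cos ((s + t) * x)" by (simp add: cos_diff \<theta>)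
    finally show ?thesis by (simp add: sin_times_sin algebra_simps diff_divide_distrib)
  qed
  have distr: "(w * i) * (C / 2 - \<sigma> * D / 2) = (1 / 2) * ((w * C) * i) - (\<sigma> / 2) * ((w * D) * i)"
    for w i C D \<sigma> :: real
    by (simp add: algebra_simps)
  have "((4 / h - x) * indicator {0..4 / h} x) * (sin (x * s - \<theta>) * sin (x * t - \<theta>)) =
     (1 / 2) * (((4 / h - x) * cos ((s - t) * x)) * indicator {0..4 / h} x) -
     (cos (2 * \<theta>) / 2) * (((4 / h - x) * cos ((s + t) * x)) * indicator {0..4 / h} x)" for x
    unfolding sc by (rule distr)
  then have eq: "(\<integral>x. ((4 / h - x) * indicator {0..4 / h} x) * (sin (x * s - \<theta>) * sin (x * t - \<theta>)) \<partial>lborel)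
      = (1 / 2) * ?K (s - t) - (cos (2 * \<theta>) / 2) * ?K (s + t)"
    by (simp only: Bochner_Integration.integral_diff[OF integrable_mult_right[OF int] integrable_mult_right[OF int]]
        integral_mult_right_zero)
  have "\<bar>(1 / 2) * ?K (s - t) - (cos (2 * \<theta>) / 2) * ?K (s + t)\<bar> \<le> (1 / 2) * \<bar>?K (s - t)\<bar> + (1 / 2) * \<bar>?K (s + t)\<bar>"
  proof -
    have "\<bar>cos (2 * \<theta>) * ?K (s + t)\<bar> \<le> \<bar>?K (s + t)\<bar>"
      using mult_right_mono[OF abs_cos_le_one[of "2 * \<theta>"], of "\<bar>?K (s + t)\<bar>"]
      by (simp add: abs_mult)
    then show ?thesis by (simp add: abs_if split: if_splits)
  qed
  also have "\<dots> \<le> 16 / (h\<^sup>2 + (s - t)\<^sup>2)"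
  proof -
    have "(s - t)\<^sup>2 \<le> (s + t)\<^sup>2" using assms(2,3) by (simp only: abs_le_square_iff[symmetric])
    then have "16 / (h\<^sup>2 + (s + t)\<^sup>2) \<le> 16 / (h\<^sup>2 + (s - t)\<^sup>2)"
      using h by (intro divide_left_mono mult_pos_pos add_pos_nonneg) auto
    then show ?thesis
      using fejer_weight_cos_bound[OF h, of "s - t"] fejer_weight_cos_bound[OF h, of "s + t"] by linarith
  qed
  finally show ?thesis unfolding eq .
qed

lemma integrable_product_pair:
  fixes u v :: "real \<Rightarrow> real"
  assumes u: "integrable lborel u" and v: "integrable lborel v"
  shows "integrable (lborel \<Otimes>\<^sub>M lborel) (\<lambda>(x, y). u x * v y)"
proof (rule lborel_pair.Fubini_integrable)
  have [measurable]: "u \<in> borel_measurable borel" "v \<in> borel_measurable borel"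
    using u v by auto
  show "(\<lambda>(x, y). u x * v y) \<in> borel_measurable (lborel \<Otimes>\<^sub>M lborel)" by measurable
  show "integrable lborel (\<lambda>x. \<integral>y. norm (case (x, y) of (x, y) \<Rightarrow> u x * v y) \<partial>lborel)"
    using u by (simp add: abs_mult)
  show "AE x in lborel. integrable lborel (\<lambda>y. case (x, y) of (x, y) \<Rightarrow> u x * v y)"
    using v by simp
qed

lemma ennreal_norm_integral_le:
  fixes f :: "'a \<Rightarrow> 'b::{banach, second_countable_topology}"
  shows "ennreal (norm (integral\<^sup>L M f)) \<le> (\<integral>\<^sup>+x. ennreal (norm (f x)) \<partial>M)"
  by (cases "integrable M f") (auto simp: integral_norm_bound_ennreal not_integrable_integral_eq)

text \<open>Expanding the square, both integrations against \<open>g\<close> are moved outside by Fubini.\<close>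

lemma weighted_square_bound:
  fixes g :: "real \<Rightarrow> complex" and W :: "real \<Rightarrow> real" and S :: "real \<Rightarrow> real \<Rightarrow> real"
  assumes g: "integrable lborel g" and W: "integrable lborel W" "\<And>x. 0 \<le> W x"
    and S [measurable]: "(\<lambda>(x, t). S x t) \<in> borel_measurable (borel \<Otimes>\<^sub>M borel)"
    and S1: "\<And>x t. \<bar>S x t\<bar> \<le> 1"
    and K: "\<And>s t. g s \<noteq> 0 \<Longrightarrow> g t \<noteq> 0 \<Longrightarrow> \<bar>\<integral>x. W x * (S x s * S x t) \<partial>lborel\<bar> \<le> K s t"
    and K_meas [measurable]: "(\<lambda>(s, t). K s t) \<in> borel_measurable (borel \<Otimes>\<^sub>M borel)"
  shows "(\<integral>\<^sup>+x. ennreal (W x * (norm (\<integral>t. g t * S x t \<partial>lborel))\<^sup>2) \<partial>lborel)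
    \<le> (\<integral>\<^sup>+s. \<integral>\<^sup>+t. ennreal (norm (g s)) * ennreal (norm (g t)) * ennreal (K s t) \<partial>lborel \<partial>lborel)"
proof -
  have [measurable]: "g \<in> borel_measurable borel" "W \<in> borel_measurable borel"
    using g W by auto
  have [measurable]: "cnj \<in> borel_measurable borel"
    by (intro borel_measurable_continuous_onI continuous_intros)
  define T where "T = (\<lambda>x. \<integral>t. g t * S x t \<partial>lborel)"
  have [measurable]: "T \<in> borel_measurable borel"
    unfolding T_def by measurable
  \<comment> \<open>\<open>B\<close> bounds \<open>T\<close> uniformly. This makes the weighted
    square integrable and gives the majorant \<open>W x * B * norm (g s)\<close> for the Fubini step
    that pulls out \<open>g s\<close>.\<close>
  define B where "B = (\<integral>t. norm (g t) \<partial>lborel)"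
  have gS: "integrable lborel (\<lambda>t. g t * S x t)" for x
    by (rule Bochner_Integration.integrable_bound[OF g])
      (use S1 in \<open>auto simp: norm_mult intro!: mult_left_le\<close>)
  have TB: "norm (T x) \<le> B" for x
  proof -
    have "norm (T x) \<le> (\<integral>t. norm (g t * S x t) \<partial>lborel)"
      unfolding T_def by (rule integral_norm_bound)
    also have "\<dots> \<le> B"
      unfolding B_def
      by (rule integral_mono[OF integrable_norm[OF gS] integrable_norm[OF g]])
        (use S1 in \<open>auto simp: norm_mult intro!: mult_left_le\<close>)
    finally show ?thesis .
  qed
  have B0: "0 \<le> B" unfolding B_def by simp
  have WT: "integrable lborel (\<lambda>x. W x * (norm (T x))\<^sup>2)"
  proof (rule Bochner_Integration.integrable_bound)
    show "integrable lborel (\<lambda>x. W x * B\<^sup>2)" using W(1) by simp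
    show "AE x in lborel. norm (W x * (norm (T x))\<^sup>2) \<le> norm (W x * B\<^sup>2)"
      using TB W(2) by (auto simp: abs_mult intro!: mult_left_mono power_mono)
  qed simp
  \<comment> \<open>The two factors of \<open>T x * cnj (T x)\<close> are expanded one at a time:
    \<open>I s\<close> still contains \<open>cnj (T x)\<close>, so each use of Fubini involves only
    two variables.\<close>
  define I where "I = (\<lambda>s. \<integral>x. complex_of_real (W x * S x s) * cnj (T x) \<partial>lborel)"
  have I_eq: "I s = (\<integral>t. cnj (g t) * complex_of_real (\<integral>x. W x * (S x s * S x t) \<partial>lborel) \<partial>lborel)" for s
  proof -
    have "I s = (\<integral>x. \<integral>t. complex_of_real (W x * (S x s * S x t)) * cnj (g t) \<partial>lborel \<partial>lborel)"
      unfolding I_def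
    proof (rule Bochner_Integration.integral_cong[OF refl])
      fix x
      have "cnj (T x) = (\<integral>t. cnj (g t * S x t) \<partial>lborel)"
        unfolding T_def by (rule Bochner_Integration.integral_cnj[symmetric])
      then show "complex_of_real (W x * S x s) * cnj (T x)
          = (\<integral>t. complex_of_real (W x * (S x s * S x t)) * cnj (g t) \<partial>lborel)"
        by (simp add: integral_mult_right_zero[symmetric] mult_ac del: integral_mult_right_zero)
    qed
    also have "\<dots> = (\<integral>t. \<integral>x. complex_of_real (W x * (S x s * S x t)) * cnj (g t) \<partial>lborel \<partial>lborel)"
    proof (rule lborel_pair.Fubini_integral[symmetric])
      show "integrable (lborel \<Otimes>\<^sub>M lborel) (\<lambda>(x, t). complex_of_real (W x * (S x s * S x t)) * cnj (g t))"
      proof (rule Bochner_Integration.integrable_bound)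
        show "integrable (lborel \<Otimes>\<^sub>M lborel) (\<lambda>(x, t). W x * norm (g t))"
          by (intro integrable_product_pair W(1) integrable_norm g)
        show "AE p in lborel \<Otimes>\<^sub>M lborel. norm (case p of (x, t) \<Rightarrow> complex_of_real (W x * (S x s * S x t)) * cnj (g t))
            \<le> norm (case p of (x, t) \<Rightarrow> W x * norm (g t))"
        proof (rule AE_I2, clarify)
          fix x t
          have "\<bar>S x s\<bar> * \<bar>S x t\<bar> \<le> 1" using S1 by (intro mult_le_one) auto
          then have "\<bar>W x\<bar> * (\<bar>S x s\<bar> * \<bar>S x t\<bar>) * norm (g t) \<le> \<bar>W x\<bar> * 1 * norm (g t)"
            by (intro mult_right_mono mult_left_mono) auto
          then show "norm (complex_of_real (W x * (S x s * S x t)) * cnj (g t)) \<le> norm (W x * norm (g t))"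
            by (simp add: norm_mult abs_mult mult_ac)
        qed
      qed measurable
    qed
    also have "\<dots> = (\<integral>t. cnj (g t) * complex_of_real (\<integral>x. W x * (S x s * S x t) \<partial>lborel) \<partial>lborel)"
      by (simp only: integral_mult_left_zero integral_complex_of_real mult.commute[of "cnj _"])
    finally show ?thesis .
  qed
  have "complex_of_real (\<integral>x. W x * (norm (T x))\<^sup>2 \<partial>lborel) = (\<integral>x. complex_of_real (W x * (norm (T x))\<^sup>2) \<partial>lborel)"
    by (simp only: integral_complex_of_real)
  also have "\<dots> = (\<integral>x. \<integral>s. complex_of_real (W x * S x s) * cnj (T x) * g s \<partial>lborel \<partial>lborel)"
  proof (rule Bochner_Integration.integral_cong[OF refl])
    fix x
    have "complex_of_real (W x * (norm (T x))\<^sup>2) = complex_of_real (W x) * cnj (T x) * T x"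
      by (simp add: complex_norm_square mult_ac del: of_real_power)
    also have "\<dots> = complex_of_real (W x) * cnj (T x) * (\<integral>s. g s * S x s \<partial>lborel)"
      by (simp only: T_def)
    also have "\<dots> = (\<integral>s. complex_of_real (W x * S x s) * cnj (T x) * g s \<partial>lborel)"
      by (subst integral_mult_right_zero[symmetric]) (simp add: mult_ac)
    finally show "complex_of_real (W x * (norm (T x))\<^sup>2)
        = (\<integral>s. complex_of_real (W x * S x s) * cnj (T x) * g s \<partial>lborel)" .
  qed
  also have "\<dots> = (\<integral>s. \<integral>x. complex_of_real (W x * S x s) * cnj (T x) * g s \<partial>lborel \<partial>lborel)"
  proof (rule lborel_pair.Fubini_integral[symmetric])
    show "integrable (lborel \<Otimes>\<^sub>M lborel) (\<lambda>(x, s). complex_of_real (W x * S x s) * cnj (T x) * g s)"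
    proof (rule Bochner_Integration.integrable_bound)
      show "integrable (lborel \<Otimes>\<^sub>M lborel) (\<lambda>(x, s). (W x * B) * norm (g s))"
        by (intro integrable_product_pair integrable_mult_left W(1) integrable_norm g)
      show "AE p in lborel \<Otimes>\<^sub>M lborel. norm (case p of (x, s) \<Rightarrow> complex_of_real (W x * S x s) * cnj (T x) * g s)
          \<le> norm (case p of (x, s) \<Rightarrow> (W x * B) * norm (g s))"
      proof (rule AE_I2, clarify)
        fix x s
        have "\<bar>S x s\<bar> * norm (T x) \<le> 1 * B" using S1 TB by (intro mult_mono) auto
        then have "\<bar>W x\<bar> * (\<bar>S x s\<bar> * norm (T x)) * norm (g s) \<le> \<bar>W x\<bar> * B * norm (g s)"
          by (intro mult_right_mono mult_left_mono) auto
        then show "norm (complex_of_real (W x * S x s) * cnj (T x) * g s) \<le> norm ((W x * B) * norm (g s))"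
          using B0 by (simp add: norm_mult abs_mult mult_ac)
      qed
    qed measurable
  qed
  also have "\<dots> = (\<integral>s. g s * I s \<partial>lborel)"
    unfolding I_def by (simp only: integral_mult_left_zero mult.commute[of "g _"])
  finally have eq: "complex_of_real (\<integral>x. W x * (norm (T x))\<^sup>2 \<partial>lborel) = (\<integral>s. g s * I s \<partial>lborel)" .
  have "(\<integral>\<^sup>+x. ennreal (W x * (norm (T x))\<^sup>2) \<partial>lborel) = ennreal (\<integral>x. W x * (norm (T x))\<^sup>2 \<partial>lborel)"
    using W(2) by (intro nn_integral_eq_integral WT) auto
  also have "(\<integral>x. W x * (norm (T x))\<^sup>2 \<partial>lborel) \<le> norm (complex_of_real (\<integral>x. W x * (norm (T x))\<^sup>2 \<partial>lborel))"
    by (simp only: norm_of_real abs_ge_self)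
  then have "ennreal (\<integral>x. W x * (norm (T x))\<^sup>2 \<partial>lborel) \<le> ennreal (norm (\<integral>s. g s * I s \<partial>lborel))"
    unfolding eq by (rule ennreal_leI)
  also have "ennreal (norm (\<integral>s. g s * I s \<partial>lborel)) \<le> (\<integral>\<^sup>+s. ennreal (norm (g s * I s)) \<partial>lborel)"
    by (rule ennreal_norm_integral_le)
  also have "\<dots> \<le> (\<integral>\<^sup>+s. \<integral>\<^sup>+t. ennreal (norm (g s)) * ennreal (norm (g t)) * ennreal (K s t) \<partial>lborel \<partial>lborel)"
  proof (rule nn_integral_mono)
    fix s
    show "ennreal (norm (g s * I s)) \<le> (\<integral>\<^sup>+t. ennreal (norm (g s)) * ennreal (norm (g t)) * ennreal (K s t) \<partial>lborel)"
    \<comment> \<open>The kernel bound is assumed only where \<open>g\<close> does not vanish;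
      elsewhere the left side is \<open>0\<close>.\<close>
    proof (cases "g s = 0")
      case False
      have "ennreal (norm (I s)) \<le> (\<integral>\<^sup>+t. ennreal (norm (cnj (g t) * complex_of_real (\<integral>x. W x * (S x s * S x t) \<partial>lborel))) \<partial>lborel)"
        unfolding I_eq by (rule ennreal_norm_integral_le)
      also have "\<dots> \<le> (\<integral>\<^sup>+t. ennreal (norm (g t)) * ennreal (K s t) \<partial>lborel)"
      proof (rule nn_integral_mono)
        fix t
        show "ennreal (norm (cnj (g t) * complex_of_real (\<integral>x. W x * (S x s * S x t) \<partial>lborel)))
          \<le> ennreal (norm (g t)) * ennreal (K s t)"
        proof (cases "g t = 0")
          case False2: False
          show ?thesis
            using K[OF False False2]
            by (simp add: norm_mult ennreal_mult'[symmetric] ennreal_leI mult_left_mono del: ennreal_mult)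
        qed simp
      qed
      finally have "ennreal (norm (g s)) * ennreal (norm (I s))
          \<le> ennreal (norm (g s)) * (\<integral>\<^sup>+t. ennreal (norm (g t)) * ennreal (K s t) \<partial>lborel)"
        by (rule mult_left_mono) simp
      also have "\<dots> = (\<integral>\<^sup>+t. ennreal (norm (g s)) * ennreal (norm (g t)) * ennreal (K s t) \<partial>lborel)"
        by (subst nn_integral_cmult[symmetric]) (auto simp: mult_ac)
      finally show ?thesis by (simp add: norm_mult ennreal_mult)
    qed simp
  qed
  finally show ?thesis unfolding T_def .
qed

subsection \<open>Schur test on dyadic blocks\<close>

lemma ennreal_le_suminf: "f i \<le> (\<Sum>j. f j)" for f :: "nat \<Rightarrow> ennreal"
  using sum_le_suminf[of f "{i}"] by simp

lemma ennreal_suminf_commute: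
  "(\<Sum>i. \<Sum>j. f i j) = (\<Sum>j. \<Sum>i. f i j)" for f :: "nat \<Rightarrow> nat \<Rightarrow> ennreal"
  using nn_integral_suminf[of "\<lambda>j i. f i j" "count_space UNIV"]
  by (simp add: nn_integral_count_space_nat)

lemma ennreal_mult_le_sum_squares: "a * b \<le> a\<^sup>2 + b\<^sup>2" for a b :: ennreal
proof (cases "a \<le> b")
  case True
  then have "a * b \<le> b\<^sup>2" by (simp add: power2_eq_square mult_right_mono)
  then show ?thesis by (rule order_trans) simp
next
  case False
  then have "a * b \<le> a\<^sup>2" by (simp add: power2_eq_square mult_left_mono)
  then show ?thesis by (rule order_trans) simp
qed

text \<open>Comparison with the telescoping terms \<open>3 / ((d + 1) * (d + 2))\<close> amounts to
  \<open>(2 * d - 1) * (d - 1) \<ge> 0\<close>, which holds at every natural \<open>d\<close>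
  although it fails between \<open>1/2\<close> and \<open>1\<close>.\<close>

lemma sum_inverse_square_le: "(\<Sum>d<n. 1 / (1 + (real d)\<^sup>2)) \<le> 3"
proof -
  have step: "1 / (1 + (real d)\<^sup>2) \<le> 3 * (1 / (real d + 1) - 1 / (real (Suc d) + 1))" for d
  proof -
    have "(2 * real d - 1) * (real d - 1) \<ge> 0"
      by (cases "d = 0") (auto intro!: mult_nonneg_nonneg)
    then have "(real d + 1) * (real d + 2) \<le> 3 * (1 + (real d)\<^sup>2)"
      by (simp add: power2_eq_square algebra_simps)
    then have "1 / (1 + (real d)\<^sup>2) \<le> 3 / ((real d + 1) * (real d + 2))"
      by (simp add: divide_le_eq le_divide_eq add_pos_nonneg)
    also have "\<dots> = 3 * (1 / (real d + 1) - 1 / (real (Suc d) + 1))"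
      by (simp add: field_simps)
    finally show ?thesis .
  qed
  have "(\<Sum>d<n. 1 / (1 + (real d)\<^sup>2)) \<le> (\<Sum>d<n. 3 * (1 / (real d + 1) - 1 / (real (Suc d) + 1)))"
    by (intro sum_mono step)
  also have "\<dots> = 3 * (1 - 1 / (real n + 1))"
    unfolding sum_distrib_left[symmetric] by (subst sum_lessThan_telescope') simp
  also have "\<dots> \<le> 3" by simp
  finally show ?thesis .
qed

text \<open>Among the indices \<open>j \<le> i\<close>, and likewise among \<open>j > i\<close>,
  every distance to \<open>i\<close> occurs at most once, so each side contributes at most
  \<open>3\<close>.\<close>

lemma suminf_inverse_square_diff_le:
  "(\<Sum>j. ennreal (1 / (1 + (real i - real j)\<^sup>2))) \<le> 6"
proof -
  have "(\<Sum>j<n. 1 / (1 + (real i - real j)\<^sup>2)) \<le> 6" for n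
  proof -
    have "(\<Sum>j<n. 1 / (1 + (real i - real j)\<^sup>2)) \<le> (\<Sum>j<Suc i + n. 1 / (1 + (real i - real j)\<^sup>2))"
      by (intro sum_mono2) auto
    also have "{..<Suc i + n} = {..<Suc i} \<union> {Suc i..<Suc i + n}" by auto
    also have "(\<Sum>j\<in>{..<Suc i} \<union> {Suc i..<Suc i + n}. 1 / (1 + (real i - real j)\<^sup>2))
      = (\<Sum>j<Suc i. 1 / (1 + (real i - real j)\<^sup>2)) + (\<Sum>j\<in>{Suc i..<Suc i + n}. 1 / (1 + (real i - real j)\<^sup>2))"
      by (intro sum.union_disjoint) auto
    also have "(\<Sum>j<Suc i. 1 / (1 + (real i - real j)\<^sup>2)) = (\<Sum>d<Suc i. 1 / (1 + (real d)\<^sup>2))"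
      by (subst sum.nat_diff_reindex[symmetric]) (auto intro!: sum.cong simp: of_nat_diff)
    also have "(\<Sum>j\<in>{Suc i..<Suc i + n}. 1 / (1 + (real i - real j)\<^sup>2)) = (\<Sum>d<n. 1 / (1 + (real (Suc d))\<^sup>2))"
      using sum.shift_bounds_nat_ivl[of "\<lambda>j. 1 / (1 + (real i - real j)\<^sup>2)" 0 "Suc i" n]
      by (auto simp: lessThan_atLeast0 add.commute power2_eq_square algebra_simps intro!: sum.cong)
    also have "\<dots> \<le> (\<Sum>d<Suc n. 1 / (1 + (real d)\<^sup>2))"
      unfolding sum.lessThan_Suc_shift by simp
    finally show ?thesis using sum_inverse_square_le[of "Suc i"] sum_inverse_square_le[of "Suc n"] by linarith
  qed
  then have "(\<Sum>j<n. ennreal (1 / (1 + (real i - real j)\<^sup>2))) \<le> 6" for n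
    by (subst sum_ennreal) (auto simp flip: ennreal_numeral intro: ennreal_leI)
  then show ?thesis by (intro suminf_le_const) auto
qed

text \<open>Schur test for a symmetric kernel with row sums at most \<open>6\<close>. After
  \<open>a i * a j \<le> (a i)\<^sup>2 + (a j)\<^sup>2\<close> the two double series agree by
  symmetry, whence \<open>12 = 6 + 6\<close>.\<close>

lemma schur_sum_bound:
  fixes a :: "nat \<Rightarrow> ennreal"
  shows "(\<Sum>i. \<Sum>j. ennreal (1 / (1 + (real i - real j)\<^sup>2)) * (a i * a j)) \<le> 12 * (\<Sum>j. (a j)\<^sup>2)"
proof -
  define \<phi> where "\<phi> = (\<lambda>i j. ennreal (1 / (1 + (real i - real j)\<^sup>2)))"
  have sym: "\<phi> i j = \<phi> j i" for i j by (simp add: \<phi>_def power2_commute)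
  have row: "(\<Sum>i. \<Sum>j. \<phi> i j * (a i)\<^sup>2) \<le> 6 * (\<Sum>i. (a i)\<^sup>2)"
  proof -
    have "(\<Sum>i. \<Sum>j. \<phi> i j * (a i)\<^sup>2) = (\<Sum>i. (\<Sum>j. \<phi> i j) * (a i)\<^sup>2)" by simp
    also have "\<dots> \<le> (\<Sum>i. 6 * (a i)\<^sup>2)"
      unfolding \<phi>_def by (intro suminf_le mult_right_mono suminf_inverse_square_diff_le) auto
    finally show ?thesis by simp
  qed
  have "(\<Sum>i. \<Sum>j. \<phi> i j * (a i * a j)) \<le> (\<Sum>i. \<Sum>j. \<phi> i j * (a i)\<^sup>2 + \<phi> i j * (a j)\<^sup>2)"
    by (intro suminf_le) (auto simp: distrib_left[symmetric] intro!: mult_left_mono ennreal_mult_le_sum_squares)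
  also have "\<dots> = (\<Sum>i. \<Sum>j. \<phi> i j * (a i)\<^sup>2) + (\<Sum>i. \<Sum>j. \<phi> i j * (a j)\<^sup>2)"
    by (simp add: suminf_add[symmetric])
  also have "(\<Sum>i. \<Sum>j. \<phi> i j * (a j)\<^sup>2) = (\<Sum>i. \<Sum>j. \<phi> i j * (a i)\<^sup>2)"
    by (subst ennreal_suminf_commute) (simp only: sym)
  also have "(\<Sum>i. \<Sum>j. \<phi> i j * (a i)\<^sup>2) + (\<Sum>i. \<Sum>j. \<phi> i j * (a i)\<^sup>2) \<le> 6 * (\<Sum>i. (a i)\<^sup>2) + 6 * (\<Sum>i. (a i)\<^sup>2)"
    by (intro add_mono row)
  also have "\<dots> = 12 * (\<Sum>i. (a i)\<^sup>2)"
    by (simp add: distrib_right[symmetric])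
  finally show ?thesis unfolding \<phi>_def .
qed

text \<open>Points of blocks at index distance \<open>d \<ge> 1\<close> are at least
  \<open>(d - 1) * h\<close> apart. The constant \<open>3\<close> suffices because \<open>3 * (1 +
  (d - 1)\<^sup>2) - (1 + d\<^sup>2) = 2 * (d - 3 / 2)\<^sup>2 + 1 / 2\<close>.\<close>

lemma block_kernel_bound:
  fixes h s t :: real
  assumes h: "0 < h" and s: "s \<in> {real i * h..<(real i + 1) * h}" and t: "t \<in> {real j * h..<(real j + 1) * h}"
  shows "1 / (h\<^sup>2 + (s - t)\<^sup>2) \<le> 3 / h\<^sup>2 * (1 / (1 + (real i - real j)\<^sup>2))"
proof -
  define d where "d = \<bar>real i - real j\<bar>"
  have "(d - 1) * h \<le> \<bar>s - t\<bar>"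
    using s t unfolding d_def by (auto simp: abs_if algebra_simps)
  have sq: "h\<^sup>2 * (1 + d\<^sup>2) \<le> 3 * (h\<^sup>2 + (s - t)\<^sup>2)"
  proof (cases "i = j")
    case True
    then show ?thesis by (simp add: d_def)
  next
    case False
    then have "1 \<le> d" unfolding d_def by linarith
    then have "((d - 1) * h)\<^sup>2 \<le> (s - t)\<^sup>2"
      using \<open>(d - 1) * h \<le> \<bar>s - t\<bar>\<close> h by (intro abs_le_square_iff[THEN iffD1]) auto
    then have le: "3 * (h\<^sup>2 + ((d - 1) * h)\<^sup>2) \<le> 3 * (h\<^sup>2 + (s - t)\<^sup>2)" by simp
    have "0 \<le> h\<^sup>2 * (2 * (d - 3 / 2)\<^sup>2 + 1 / 2)" by (intro mult_nonneg_nonneg) auto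
    moreover have "3 * (h\<^sup>2 + ((d - 1) * h)\<^sup>2) - h\<^sup>2 * (1 + d\<^sup>2) = h\<^sup>2 * (2 * (d - 3 / 2)\<^sup>2 + 1 / 2)"
      by (simp add: power2_eq_square field_simps)
    ultimately have "0 \<le> 3 * (h\<^sup>2 + ((d - 1) * h)\<^sup>2) - h\<^sup>2 * (1 + d\<^sup>2)" by (simp only:)
    then have "h\<^sup>2 * (1 + d\<^sup>2) \<le> 3 * (h\<^sup>2 + ((d - 1) * h)\<^sup>2)" by (simp only: diff_ge_0_iff_ge)
    then show ?thesis using le by (rule order_trans)
  qed
  have "0 < h\<^sup>2 + (s - t)\<^sup>2" "0 < 1 + d\<^sup>2" "0 < h\<^sup>2"
    using h by (auto simp: add_pos_nonneg)
  then have "1 / (h\<^sup>2 + (s - t)\<^sup>2) \<le> 3 / (h\<^sup>2 * (1 + d\<^sup>2))"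
    using sq by (simp add: divide_le_eq le_divide_eq mult.commute)
  also have "\<dots> = 3 / h\<^sup>2 * (1 / (1 + d\<^sup>2))" by simp
  finally show ?thesis by (simp add: d_def)
qed

text \<open>A pair of nonnegative points lies in exactly one pair of blocks, where the kernel is
  bounded by its discrete counterpart. Enlarging that single term to the full double series
  separates the variables and leaves the Schur sum of the block masses;
  \<open>576 = 16 * 3 * 12\<close>.\<close>

lemma kernel_form_block_bound:
  fixes G :: "real \<Rightarrow> ennreal" and h :: real
  assumes [measurable]: "G \<in> borel_measurable borel" and h: "0 < h" and G0: "\<And>t. t < 0 \<Longrightarrow> G t = 0"
  shows "(\<integral>\<^sup>+s. \<integral>\<^sup>+t. G s * G t * ennreal (16 / (h\<^sup>2 + (s - t)\<^sup>2)) \<partial>lborel \<partial>lborel)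
    \<le> ennreal (576 / h\<^sup>2) * (\<Sum>j. (\<integral>\<^sup>+t. G t * indicator {real j * h..<(real j + 1) * h} t \<partial>lborel)\<^sup>2)"
proof -
  define b where "b = (\<lambda>j t. G t * indicator {real j * h..<(real j + 1) * h} t)"
  have [measurable]: "b j \<in> borel_measurable borel" for j unfolding b_def by measurable
  define \<phi> where "\<phi> = (\<lambda>i j. ennreal (1 / (1 + (real i - real j)\<^sup>2)))"
  define c where "c = ennreal (48 / h\<^sup>2)"
  have pw: "G s * G t * ennreal (16 / (h\<^sup>2 + (s - t)\<^sup>2)) \<le> (\<Sum>i. \<Sum>j. c * (\<phi> i j * (b i s * b j t)))" for s t
  proof (cases "s < 0 \<or> t < 0")
    case True
    then show ?thesis using G0 by auto
  next
    case False
    define i where "i = nat \<lfloor>s / h\<rfloor>"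
    define j where "j = nat \<lfloor>t / h\<rfloor>"
    have blk: "u \<in> {real (nat \<lfloor>u / h\<rfloor>) * h..<(real (nat \<lfloor>u / h\<rfloor>) + 1) * h}" if "\<not> u < 0" for u
    proof -
      have "0 \<le> u / h" using that h by simp
      then have "real (nat \<lfloor>u / h\<rfloor>) \<le> u / h" "u / h < real (nat \<lfloor>u / h\<rfloor>) + 1" by linarith+
      then show ?thesis using h by (simp add: le_divide_eq divide_less_eq)
    qed
    have s: "s \<in> {real i * h..<(real i + 1) * h}" and t: "t \<in> {real j * h..<(real j + 1) * h}"
      using blk False unfolding i_def j_def by blast+
    have "16 / (h\<^sup>2 + (s - t)\<^sup>2) \<le> 48 / h\<^sup>2 * (1 / (1 + (real i - real j)\<^sup>2))"
      using mult_left_mono[OF block_kernel_bound[OF h s t], of 16] by simp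
    then have "ennreal (16 / (h\<^sup>2 + (s - t)\<^sup>2)) \<le> c * \<phi> i j"
      unfolding c_def \<phi>_def by (subst ennreal_mult[symmetric]) (auto intro: ennreal_leI)
    then have "G s * G t * ennreal (16 / (h\<^sup>2 + (s - t)\<^sup>2)) \<le> G s * G t * (c * \<phi> i j)"
      by (rule mult_left_mono) simp
    also have "\<dots> = c * (\<phi> i j * (b i s * b j t))"
      unfolding b_def using s t by (simp add: mult_ac)
    also have "\<dots> \<le> (\<Sum>j. c * (\<phi> i j * (b i s * b j t)))"
      by (rule ennreal_le_suminf)
    also have "\<dots> \<le> (\<Sum>i. \<Sum>j. c * (\<phi> i j * (b i s * b j t)))"
      by (rule ennreal_le_suminf[of "\<lambda>i. \<Sum>j. c * (\<phi> i j * (b i s * b j t))"])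
    finally show ?thesis .
  qed
  have "(\<integral>\<^sup>+s. \<integral>\<^sup>+t. G s * G t * ennreal (16 / (h\<^sup>2 + (s - t)\<^sup>2)) \<partial>lborel \<partial>lborel)
    \<le> (\<integral>\<^sup>+s. \<integral>\<^sup>+t. (\<Sum>i. \<Sum>j. c * (\<phi> i j * (b i s * b j t))) \<partial>lborel \<partial>lborel)"
    by (intro nn_integral_mono pw)
  also have "\<dots> = (\<Sum>i. \<Sum>j. c * (\<phi> i j * (integral\<^sup>N lborel (b i) * integral\<^sup>N lborel (b j))))"
    by (simp add: nn_integral_suminf nn_integral_cmult nn_integral_multc)
  also have "\<dots> = c * (\<Sum>i. \<Sum>j. \<phi> i j * (integral\<^sup>N lborel (b i) * integral\<^sup>N lborel (b j)))"
    by simp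
  also have "\<dots> \<le> c * (12 * (\<Sum>j. (integral\<^sup>N lborel (b j))\<^sup>2))"
    unfolding \<phi>_def by (intro mult_left_mono schur_sum_bound) simp
  also have "\<dots> = ennreal (576 / h\<^sup>2) * (\<Sum>j. (integral\<^sup>N lborel (b j))\<^sup>2)"
  proof -
    have "c * 12 = ennreal (48 / h\<^sup>2 * 12)"
      unfolding c_def by (subst ennreal_mult) auto
    then show ?thesis by (simp add: mult.assoc[symmetric])
  qed
  finally show ?thesis unfolding b_def .
qed

section \<open>The square estimate on one dyadic range of \<open>x\<close>\<close>

lemma ennreal_le_if_square_le:
  assumes "x\<^sup>2 \<le> ennreal (r\<^sup>2)" "0 \<le> r"
  shows "x \<le> ennreal r"
proof (cases x)
  case (real y)
  then have "y\<^sup>2 \<le> r\<^sup>2" using assms by (simp add: ennreal_power)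
  then have "y \<le> r" using assms(2) by (rule power2_le_imp_le)
  then show ?thesis using real by (simp add: ennreal_leI)
next
  case top
  then show ?thesis using assms(1) by (simp add: top_unique)
qed

text \<open>Cauchy-Schwarz separates \<open>1 / x\<close> from the transform. On the range,
  \<open>1 / x \<le> h\<close> and the length is \<open>1 / h\<close>, so the first factor is at
  most \<open>h\<close>. The weight vanishes only at \<open>4 / h\<close>, twice the right end, so
  it is at least \<open>2 / h\<close> on the range and inserting it costs \<open>h / 2\<close>.
  Hence \<open>288 = 576 / 2\<close>.\<close>

lemma sine_transform_dyadic_bound:
  fixes g :: "real \<Rightarrow> complex" and h \<theta> :: real
  assumes g: "integrable lborel g" and h: "0 < h" and g0: "\<And>t. t < 0 \<Longrightarrow> g t = 0" and \<theta>: "sin (2 * \<theta>) = 0"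
  shows "(\<integral>\<^sup>+x. ennreal (1 / x * norm (\<integral>t. g t * sin (x * t - \<theta>) \<partial>lborel)) * indicator {1 / h..<2 / h} x \<partial>lborel)\<^sup>2
    \<le> 288 * (\<Sum>j. (\<integral>\<^sup>+t. ennreal (norm (g t)) * indicator {real j * h..<(real j + 1) * h} t \<partial>lborel)\<^sup>2)"
    (is "?L\<^sup>2 \<le> 288 * ?R")
proof -
  have [measurable]: "g \<in> borel_measurable borel" using g by auto
  define T where "T = (\<lambda>x. \<integral>t. g t * sin (x * t - \<theta>) \<partial>lborel)"
  have [measurable]: "T \<in> borel_measurable borel" unfolding T_def by measurable
  let ?I = "{1 / h..<2 / h}"
  define W where "W = (\<lambda>x. (4 / h - x) * indicator {0..4 / h} x :: real)"
  have W0: "0 \<le> W x" for x unfolding W_def by (auto simp: indicator_def)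
  have W_int: "integrable lborel W"
    using fejer_weight_cos_integral[of "4 / h" 0] h unfolding W_def by (auto simp: has_bochner_integral_iff)
  have "(\<integral>\<^sup>+x. ennreal (W x * (norm (T x))\<^sup>2) \<partial>lborel)
      \<le> (\<integral>\<^sup>+s. \<integral>\<^sup>+t. ennreal (norm (g s)) * ennreal (norm (g t)) * ennreal (16 / (h\<^sup>2 + (s - t)\<^sup>2)) \<partial>lborel \<partial>lborel)"
    unfolding T_def
  proof (rule weighted_square_bound[OF g W_int W0])
    fix s t assume "g s \<noteq> 0" "g t \<noteq> 0"
    then have "0 \<le> s" "0 \<le> t" using g0 not_less by blast+
    then show "\<bar>\<integral>x. W x * (sin (x * s - \<theta>) * sin (x * t - \<theta>)) \<partial>lborel\<bar> \<le> 16 / (h\<^sup>2 + (s - t)\<^sup>2)"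
      unfolding W_def by (rule fejer_weight_sin_sin_bound[OF h _ _ \<theta>])
  qed (auto intro: abs_sin_le_one)
  also have "\<dots> \<le> ennreal (576 / h\<^sup>2) * ?R"
    by (rule kernel_form_block_bound[OF _ h]) (auto simp: g0)
  finally have WT: "(\<integral>\<^sup>+x. ennreal (W x * (norm (T x))\<^sup>2) \<partial>lborel) \<le> ennreal (576 / h\<^sup>2) * ?R" .
  have "?L\<^sup>2 = (\<integral>\<^sup>+x. (ennreal (1 / x) * indicator ?I x) * (ennreal (norm (T x)) * indicator ?I x) \<partial>lborel)\<^sup>2"
    unfolding T_def ennreal_mult''[OF norm_ge_zero]
    by (intro arg_cong[where f = "\<lambda>x. x\<^sup>2"] nn_integral_cong) (simp add: indicator_def)
  also have "\<dots> \<le> (\<integral>\<^sup>+x. (ennreal (1 / x) * indicator ?I x)\<^sup>2 \<partial>lborel) * (\<integral>\<^sup>+x. (ennreal (norm (T x)) * indicator ?I x)\<^sup>2 \<partial>lborel)"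
    by (rule Cauchy_Schwarz_nn_integral) measurable
  also have "\<dots> \<le> ennreal h * (ennreal (h / 2) * (ennreal (576 / h\<^sup>2) * ?R))"
  proof (rule mult_mono)
    have "(\<integral>\<^sup>+x. (ennreal (1 / x) * indicator ?I x)\<^sup>2 \<partial>lborel) \<le> (\<integral>\<^sup>+x. ennreal (h\<^sup>2) * indicator ?I x \<partial>lborel)"
    proof (rule nn_integral_mono)
      fix x
      show "(ennreal (1 / x) * indicator ?I x)\<^sup>2 \<le> ennreal (h\<^sup>2) * indicator ?I x"
      proof (cases "x \<in> ?I")
        case True
        then have "0 < x" using h by (auto intro: less_le_trans[of 0 "1 / h"])
        moreover have "1 / x \<le> h" using True h \<open>0 < x\<close> by (auto simp: field_simps)
        ultimately show ?thesis using True h by (simp add: ennreal_power ennreal_leI power_mono)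
      qed simp
    qed
    also have "\<dots> = ennreal (h\<^sup>2) * ennreal (2 / h - 1 / h)"
      using h by (simp add: nn_integral_cmult_indicator divide_right_mono)
    also have "\<dots> = ennreal h"
      using h by (subst ennreal_mult[symmetric]) (auto simp: power2_eq_square field_simps)
    finally show "(\<integral>\<^sup>+x. (ennreal (1 / x) * indicator ?I x)\<^sup>2 \<partial>lborel) \<le> ennreal h" .
    have "(\<integral>\<^sup>+x. (ennreal (norm (T x)) * indicator ?I x)\<^sup>2 \<partial>lborel)
      \<le> (\<integral>\<^sup>+x. ennreal (h / 2) * ennreal (W x * (norm (T x))\<^sup>2) \<partial>lborel)"
    proof (rule nn_integral_mono)
      fix x
      show "(ennreal (norm (T x)) * indicator ?I x)\<^sup>2 \<le> ennreal (h / 2) * ennreal (W x * (norm (T x))\<^sup>2)"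
      proof (cases "x \<in> ?I")
        case True
        have "0 \<le> 1 / h" "2 / h \<le> 4 / h" using h by (auto simp: divide_right_mono)
        then have "x \<in> {0..4 / h}" using True by auto
        moreover have "2 / h \<le> 4 / h - x" using True by auto
        ultimately have "2 / h \<le> W x" unfolding W_def by simp
        then have "h / 2 * (2 / h) \<le> h / 2 * W x" using h by (intro mult_left_mono) auto
        then have "1 \<le> h / 2 * W x" using h by simp
        then have "1 * (norm (T x))\<^sup>2 \<le> (h / 2 * W x) * (norm (T x))\<^sup>2"
          by (rule mult_right_mono) simp
        then show ?thesis
          using True h W0 by (simp add: ennreal_power ennreal_leI mult.assoc flip: ennreal_mult)
      qed simp
    qed
    also have "\<dots> = ennreal (h / 2) * (\<integral>\<^sup>+x. ennreal (W x * (norm (T x))\<^sup>2) \<partial>lborel)"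
      using W_int by (intro nn_integral_cmult) auto
    also have "\<dots> \<le> ennreal (h / 2) * (ennreal (576 / h\<^sup>2) * ?R)"
      by (intro mult_left_mono WT) simp
    finally show "(\<integral>\<^sup>+x. (ennreal (norm (T x)) * indicator ?I x)\<^sup>2 \<partial>lborel) \<le> ennreal (h / 2) * (ennreal (576 / h\<^sup>2) * ?R)" .
  qed auto
  also have "\<dots> = 288 * ?R"
  proof -
    have "ennreal h * (ennreal (h / 2) * ennreal (576 / h\<^sup>2)) = ennreal (h * (h / 2 * (576 / h\<^sup>2)))"
      using h by (subst ennreal_mult, simp, simp, subst ennreal_mult) simp_all
    also have "h * (h / 2 * (576 / h\<^sup>2)) = 288" using h by (simp add: power2_eq_square field_simps)
    finally show ?thesis by (simp add: mult.assoc[symmetric])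
  qed
  finally show ?thesis .
qed

section \<open>Dyadic decomposition of the half-line\<close>

lemma dyadic_interval_exists:
  fixes x :: real
  assumes "0 < x"
  shows "\<exists>k::int. 2 powi k \<le> x \<and> x < 2 * 2 powi k"
proof -
  define k where "k = \<lfloor>log 2 x\<rfloor>"
  have "2 powr real_of_int k \<le> 2 powr log 2 x" unfolding k_def by (intro powr_mono) auto
  moreover have "2 powr log 2 x < 2 powr (real_of_int k + 1)" unfolding k_def by (intro powr_less_mono) linarith+
  ultimately have "2 powi k \<le> x \<and> x < 2 * 2 powi k"
    using assms by (simp add: powr_add powr_real_of_int' mult.commute)
  then show ?thesis by blast
qed

lemma nn_integral_dyadic_le:
  fixes \<phi> :: "real \<Rightarrow> ennreal" and e :: "int \<Rightarrow> int"
  assumes [measurable]: "\<phi> \<in> borel_measurable borel" and "surj e"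
  shows "(\<integral>\<^sup>+x. \<phi> x * indicator {0<..} x \<partial>lborel)
    \<le> (\<Sum>n. \<integral>\<^sup>+x. \<phi> x * indicator {2 powi e (int_decode n)..<2 * 2 powi e (int_decode n)} x \<partial>lborel)"
proof -
  have "(\<integral>\<^sup>+x. \<phi> x * indicator {0<..} x \<partial>lborel)
    \<le> (\<integral>\<^sup>+x. (\<Sum>n. \<phi> x * indicator {2 powi e (int_decode n)..<2 * 2 powi e (int_decode n)} x) \<partial>lborel)"
  proof (rule nn_integral_mono)
    fix x :: real
    show "\<phi> x * indicator {0<..} x \<le> (\<Sum>n. \<phi> x * indicator {2 powi e (int_decode n)..<2 * 2 powi e (int_decode n)} x)"
    proof (cases "0 < x")
      case True
      then obtain k :: int where k: "2 powi k \<le> x" "x < 2 * 2 powi k" using dyadic_interval_exists by blast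
      obtain m where "k = e m" using \<open>surj e\<close> by blast
      then have "k = e (int_decode (int_encode m))" by simp
      then show ?thesis
        using ennreal_le_suminf[of "\<lambda>n. \<phi> x * indicator {2 powi e (int_decode n)..<2 * 2 powi e (int_decode n)} x" "int_encode m"]
          k True by simp
    qed simp
  qed
  also have "\<dots> = (\<Sum>n. \<integral>\<^sup>+x. \<phi> x * indicator {2 powi e (int_decode n)..<2 * 2 powi e (int_decode n)} x \<partial>lborel)"
    by (intro nn_integral_suminf) measurable
  finally show ?thesis .
qed

text \<open>Carries the integer-indexed sum in the norm to a series over the naturals, the form in
  which sums are exchanged with nonnegative integrals.\<close>

lemma suminf_ennreal_int_decode:
  fixes N :: "int \<Rightarrow> real"
  assumes "N summable_on UNIV" "\<And>m. 0 \<le> N m"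
  shows "(\<Sum>n. ennreal (N (int_decode n))) = ennreal (\<Sum>\<^sub>\<infinity>m. N m)"
proof -
  have "(N has_sum (\<Sum>\<^sub>\<infinity>m. N m)) UNIV" using assms(1) by simp
  then have "((\<lambda>n. N (int_decode n)) has_sum (\<Sum>\<^sub>\<infinity>m. N m)) UNIV"
    using has_sum_reindex_bij_betw[OF bij_int_decode, of N "\<Sum>\<^sub>\<infinity>m. N m"] by simp
  then have "(\<lambda>n. N (int_decode n)) sums (\<Sum>\<^sub>\<infinity>m. N m)" by (rule has_sum_imp_sums)
  then show ?thesis
    using assms(2) by (simp add: suminf_ennreal2 sums_iff)
qed

subsection \<open>The remainder\<close>

text \<open>For \<open>\<theta> = 0\<close> this is \<open>sin u\<close>; for
  \<open>\<theta> = pi / 2\<close> it is \<open>1 - cos u\<close> before \<open>pi / 2\<close> and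
  \<open>- cos u\<close> from there on.\<close>

definition remainder_weight :: "real \<Rightarrow> real \<Rightarrow> real" where
  "remainder_weight \<theta> u = sin (u - \<theta>) + (if u < pi / 2 then sin \<theta> else 0)"

text \<open>For \<open>\<theta> = pi / 2\<close> the first branch is at most
  \<open>u\<^sup>2 / 2 \<le> u\<close>, since \<open>u < pi / 2 < 2\<close>; from the jump on,
  \<open>u \<ge> 1\<close> dominates the cosine.\<close>

lemma abs_remainder_weight_le:
  assumes "\<theta> = 0 \<or> \<theta> = pi / 2" "0 \<le> u"
  shows "\<bar>remainder_weight \<theta> u\<bar> \<le> u"
  using assms(1)
proof
  assume "\<theta> = 0"
  then show ?thesis using abs_sin_x_le_abs_x[of u] assms(2) by (simp add: remainder_weight_def)
next
  assume \<theta>: "\<theta> = pi / 2"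
  have c: "sin (u - pi / 2) = - cos u" by (simp add: sin_diff)
  show ?thesis
  proof (cases "u < pi / 2")
    case True
    then have "u \<le> 2" using pi_half_less_two by linarith
    then have "u\<^sup>2 / 2 \<le> u" using mult_left_mono[of u 2 u] assms(2) by (simp add: power2_eq_square)
    then show ?thesis
      using one_minus_cos_le[of u] True cos_le_one[of u] by (simp add: remainder_weight_def \<theta> c)
  next
    case False
    then have "1 \<le> u" using pi_ge_two by linarith
    then show ?thesis using order_trans[OF abs_cos_le_one[of u]] False by (simp add: remainder_weight_def \<theta> c)
  qed
qed

lemma remainder_weight_measurable [measurable]: "remainder_weight \<theta> \<in> borel_measurable borel"
  unfolding remainder_weight_def by measurable

text \<open>The cut-off \<open>t = h\<close> and the jump at \<open>x * t = pi / 2\<close> do not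
  coincide, but for these \<open>x\<close> both occur at a value of \<open>x * t\<close> in
  \<open>[1, 2)\<close>. Below \<open>h\<close> the difference is the whole weight; above
  \<open>h\<close> it is \<open>sin \<theta>\<close> before the jump, where
  \<open>x * t \<ge> 1\<close>, and \<open>0\<close> after it.\<close>

lemma remainder_weight_sine_diff:
  assumes \<theta>: "\<theta> = 0 \<or> \<theta> = pi / 2" and h: "0 < h" and x: "x \<in> {1 / h..<2 / h}" and t: "0 < t"
  shows "\<bar>remainder_weight \<theta> (x * t) - indicator {h..} t * sin (x * t - \<theta>)\<bar> \<le> x * t * indicator {..<2} (x * t)"
proof -
  have "0 < 1 / h" using h by simp
  then have x0: "0 < x" using x by (auto intro: less_le_trans)
  have xh: "1 \<le> x * h" "x * h < 2" using x h by (auto simp: field_simps)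
  show ?thesis
  proof (cases "t < h")
    case True
    then have "x * t < x * h" using x0 by simp
    then have "x * t < 2" using xh(2) by linarith
    then show ?thesis using abs_remainder_weight_le[OF \<theta>, of "x * t"] x0 t True by simp
  next
    case False
    then have "x * h \<le> x * t" using x0 by simp
    then have "1 \<le> x * t" using xh(1) by linarith
    show ?thesis
    proof (cases "x * t < pi / 2")
      case True
      then have "x * t < 2" using pi_half_less_two by linarith
      then show ?thesis using True False order_trans[OF abs_sin_le_one[of \<theta>] \<open>1 \<le> x * t\<close>] by (simp add: remainder_weight_def)
    next
      case False2: False
      then show ?thesis using False \<open>1 \<le> x * t\<close> by (simp add: remainder_weight_def)
    qed
  qed
qed

text \<open>The error \<open>d\<close> of replacing the weight by a sine cut off at \<open>h\<close>
  has a factor \<open>x\<close> in its bound, which cancels \<open>1 / x\<close>. What remains no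
  longer mentions \<open>h\<close>, so it can be integrated over all \<open>x\<close> at
  once.\<close>

lemma remainder_pointwise_bound:
  fixes g :: "real \<Rightarrow> complex"
  assumes g: "integrable lborel g" and g0: "\<And>t. t \<le> 0 \<Longrightarrow> g t = 0"
    and \<theta>: "\<theta> = 0 \<or> \<theta> = pi / 2" and h: "0 < h" and x: "x \<in> {1 / h..<2 / h}"
  shows "ennreal (1 / x * norm (\<integral>t. g t * remainder_weight \<theta> (x * t) \<partial>lborel))
    \<le> (\<integral>\<^sup>+t. ennreal (norm (g t) * t) * indicator {..<2} (x * t) \<partial>lborel)
      + ennreal (1 / x * norm (\<integral>t. (indicator {h..} t * g t) * sin (x * t - \<theta>) \<partial>lborel))"
proof -
  have [measurable]: "g \<in> borel_measurable borel" using g by auto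
  have "0 < 1 / h" using h by simp
  then have x0: "0 < x" using x by (auto intro: less_le_trans)
  have i2: "integrable lborel (\<lambda>t. (indicator {h..} t * g t) * sin (x * t - \<theta>))"
    by (rule Bochner_Integration.integrable_bound[OF g])
      (auto simp: norm_mult indicator_def intro!: mult_left_le)
  define d where "d = (\<lambda>t. remainder_weight \<theta> (x * t) - indicator {h..} t * sin (x * t - \<theta>))"
  have [measurable]: "d \<in> borel_measurable borel" unfolding d_def by measurable
  have d_le: "norm (g t * complex_of_real (d t)) \<le> x * (norm (g t) * t) * indicator {..<2} (x * t)" for t
  proof (cases "t \<le> 0")
    case False
    then have "\<bar>d t\<bar> \<le> x * t * indicator {..<2} (x * t)"
      unfolding d_def by (intro remainder_weight_sine_diff[OF \<theta> h x]) simp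
    then have "norm (g t) * \<bar>d t\<bar> \<le> norm (g t) * (x * t * indicator {..<2} (x * t))"
      by (rule mult_left_mono) simp
    then show ?thesis by (simp add: norm_mult mult_ac)
  qed (simp add: g0)
  have i1: "integrable lborel (\<lambda>t. g t * complex_of_real (d t))"
  proof (rule Bochner_Integration.integrable_bound)
    show "integrable lborel (\<lambda>t. 2 * g t)" using g by simp
    show "AE t in lborel. norm (g t * complex_of_real (d t)) \<le> norm (2 * g t)"
    proof (rule AE_I2)
      fix t
      have "x * (norm (g t) * t) * indicator {..<2} (x * t) = norm (g t) * (x * t * indicator {..<2} (x * t))" by simp
      also have "\<dots> \<le> norm (g t) * 2" by (intro mult_left_mono) (auto simp: indicator_def)
      finally show "norm (g t * complex_of_real (d t)) \<le> norm (2 * g t)"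
        using d_le[of t] by (simp add: norm_mult)
    qed
  qed measurable
  have split_sum: "ennreal (c * n) \<le> ennreal c * ennreal a + ennreal (c * b)"
    if "c * n \<le> c * (a + b)" "0 \<le> c" "0 \<le> a" "0 \<le> b" for a b c n :: real
  proof -
    have "ennreal (c * n) \<le> ennreal (c * a + c * b)"
      using that(1) by (intro ennreal_leI) (simp add: distrib_left)
    also have "\<dots> = ennreal (c * a) + ennreal (c * b)" using that by (intro ennreal_plus) auto
    also have "ennreal (c * a) = ennreal c * ennreal a" using that by (intro ennreal_mult) auto
    finally show ?thesis .
  qed
  have "(\<integral>t. g t * remainder_weight \<theta> (x * t) \<partial>lborel)
      = (\<integral>t. g t * complex_of_real (d t) + (indicator {h..} t * g t) * sin (x * t - \<theta>) \<partial>lborel)"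
    by (intro Bochner_Integration.integral_cong refl) (simp add: d_def algebra_simps indicator_def)
  also have "\<dots> = (\<integral>t. g t * complex_of_real (d t) \<partial>lborel) + (\<integral>t. (indicator {h..} t * g t) * sin (x * t - \<theta>) \<partial>lborel)"
    by (rule Bochner_Integration.integral_add[OF i1 i2])
  finally have "1 / x * norm (\<integral>t. g t * remainder_weight \<theta> (x * t) \<partial>lborel)
      \<le> 1 / x * (norm (\<integral>t. g t * complex_of_real (d t) \<partial>lborel) + norm (\<integral>t. (indicator {h..} t * g t) * sin (x * t - \<theta>) \<partial>lborel))"
    using x0 by (intro mult_left_mono) (auto simp: norm_triangle_ineq)
  then have "ennreal (1 / x * norm (\<integral>t. g t * remainder_weight \<theta> (x * t) \<partial>lborel))
      \<le> ennreal (1 / x) * ennreal (norm (\<integral>t. g t * complex_of_real (d t) \<partial>lborel))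
        + ennreal (1 / x * norm (\<integral>t. (indicator {h..} t * g t) * sin (x * t - \<theta>) \<partial>lborel))"
    using x0 by (intro split_sum) auto
  also have "ennreal (1 / x) * ennreal (norm (\<integral>t. g t * complex_of_real (d t) \<partial>lborel))
      \<le> ennreal (1 / x) * (\<integral>\<^sup>+t. ennreal (norm (g t * complex_of_real (d t))) \<partial>lborel)"
    by (intro mult_left_mono ennreal_norm_integral_le) simp
  also have "\<dots> = (\<integral>\<^sup>+t. ennreal (1 / x) * ennreal (norm (g t * complex_of_real (d t))) \<partial>lborel)"
    by (intro nn_integral_cmult[symmetric]) measurable
  also have "\<dots> \<le> (\<integral>\<^sup>+t. ennreal (norm (g t) * t) * indicator {..<2} (x * t) \<partial>lborel)"
  proof (rule nn_integral_mono)
    fix t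
    have "1 / x * norm (g t * complex_of_real (d t)) \<le> 1 / x * (x * (norm (g t) * t) * indicator {..<2} (x * t))"
      using x0 by (intro mult_left_mono d_le) simp
    also have "\<dots> = norm (g t) * t * indicator {..<2} (x * t)" using x0 by simp
    finally have le: "1 / x * norm (g t * complex_of_real (d t)) \<le> norm (g t) * t * indicator {..<2} (x * t)" .
    have "ennreal (1 / x) * ennreal (norm (g t * complex_of_real (d t))) = ennreal (1 / x * norm (g t * complex_of_real (d t)))"
      by (rule ennreal_mult''[OF norm_ge_zero, symmetric])
    also have "\<dots> \<le> ennreal (norm (g t) * t * indicator {..<2} (x * t))"
      by (rule ennreal_leI[OF le])
    also have "\<dots> = ennreal (norm (g t) * t) * indicator {..<2} (x * t)"
      by (simp add: indicator_def)
    finally show "ennreal (1 / x) * ennreal (norm (g t * complex_of_real (d t)))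
      \<le> ennreal (norm (g t) * t) * indicator {..<2} (x * t)" .
  qed
  finally show ?thesis by (simp add: add_right_mono)
qed

text \<open>By Tonelli the \<open>x\<close>-integral may come first: the slice
  \<open>0 < x < 2 / t\<close> has length \<open>2 / t\<close>, which cancels the factor
  \<open>t\<close>.\<close>

lemma nn_integral_hyperbola:
  fixes g :: "real \<Rightarrow> complex"
  assumes [measurable]: "g \<in> borel_measurable borel" and g0: "\<And>t. t \<le> 0 \<Longrightarrow> g t = 0"
  shows "(\<integral>\<^sup>+x. (\<integral>\<^sup>+t. ennreal (norm (g t) * t) * indicator {..<2} (x * t) \<partial>lborel) * indicator {0<..} x \<partial>lborel)
    = 2 * (\<integral>\<^sup>+t. ennreal (norm (g t)) \<partial>lborel)"
proof -
  have "(\<integral>\<^sup>+x. (\<integral>\<^sup>+t. ennreal (norm (g t) * t) * indicator {..<2} (x * t) \<partial>lborel) * indicator {0<..} x \<partial>lborel)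
     = (\<integral>\<^sup>+x. \<integral>\<^sup>+t. ennreal (norm (g t) * t) * indicator {..<2} (x * t) * indicator {0<..} x \<partial>lborel \<partial>lborel)"
    by (intro nn_integral_cong nn_integral_multc[symmetric]) measurable
  also have "\<dots> = (\<integral>\<^sup>+t. \<integral>\<^sup>+x. ennreal (norm (g t) * t) * indicator {..<2} (x * t) * indicator {0<..} x \<partial>lborel \<partial>lborel)"
    by (rule lborel_pair.Fubini'[symmetric]) measurable
  also have "\<dots> = (\<integral>\<^sup>+t. 2 * ennreal (norm (g t)) \<partial>lborel)"
  proof (rule nn_integral_cong)
    fix t :: real
    show "(\<integral>\<^sup>+x. ennreal (norm (g t) * t) * indicator {..<2} (x * t) * indicator {0<..} x \<partial>lborel) = 2 * ennreal (norm (g t))"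
    proof (cases "t \<le> 0")
      case False
      then have "(\<integral>\<^sup>+x. ennreal (norm (g t) * t) * indicator {..<2} (x * t) * indicator {0<..} x \<partial>lborel)
          = (\<integral>\<^sup>+x. ennreal (norm (g t) * t) * indicator {0<..<2 / t} x \<partial>lborel)"
        by (intro nn_integral_cong) (auto simp: indicator_def field_simps)
      also have "\<dots> = ennreal (norm (g t) * t) * ennreal (2 / t)"
        using False by (simp add: nn_integral_cmult_indicator)
      also have "\<dots> = ennreal (norm (g t) * 2)"
        using False by (subst ennreal_mult[symmetric]) auto
      finally show ?thesis by (simp add: ennreal_mult mult.commute)
    qed (simp add: g0)
  qed
  also have "\<dots> = 2 * (\<integral>\<^sup>+t. ennreal (norm (g t)) \<partial>lborel)"
    by (rule nn_integral_cmult) measurable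
  finally show ?thesis .
qed

lemma remainder_integral_bound:
  fixes g :: "real \<Rightarrow> complex" and N :: "int \<Rightarrow> real"
  assumes g: "integrable lborel g" and g0: "\<And>t. t \<le> 0 \<Longrightarrow> g t = 0"
    and \<theta>: "\<theta> = 0 \<or> \<theta> = pi / 2"
    and N0: "\<And>m. 0 \<le> N m" and N: "N summable_on UNIV"
    and blocks: "\<And>m. (\<Sum>j. (\<integral>\<^sup>+t. ennreal (norm (g t)) *
        indicator {real (Suc j) * 2 powi m..<(real (Suc j) + 1) * 2 powi m} t \<partial>lborel)\<^sup>2) \<le> ennreal ((N m)\<^sup>2)"
    and J: "(\<integral>\<^sup>+t. ennreal (norm (g t)) \<partial>lborel) \<le> ennreal (\<Sum>\<^sub>\<infinity>m. N m)"
  shows "(\<integral>\<^sup>+x. ennreal (1 / x * norm (\<integral>t. g t * remainder_weight \<theta> (x * t) \<partial>lborel)) * indicator {0<..} x \<partial>lborel)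
    \<le> ennreal (19 * (\<Sum>\<^sub>\<infinity>m. N m))"
proof -
  have [measurable]: "g \<in> borel_measurable borel" using g by auto
  define S where "S = (\<Sum>\<^sub>\<infinity>m. N m)"
  have S0: "0 \<le> S" unfolding S_def by (rule infsum_nonneg) (rule N0)
  define P where "P = (\<lambda>x. \<integral>\<^sup>+t. ennreal (norm (g t) * t) * indicator {..<2} (x * t) \<partial>lborel)"
  define T where "T = (\<lambda>m x. \<integral>t. (indicator {2 powi m..} t * g t) * sin (x * t - \<theta>) \<partial>lborel)"
  define I where "I = (\<lambda>m::int. {1 / 2 powi m..<2 / 2 powi m :: real})"
  have [measurable]: "P \<in> borel_measurable borel" unfolding P_def by measurable
  have [measurable]: "T m \<in> borel_measurable borel" for m unfolding T_def by measurable
  have [measurable]: "I m \<in> sets borel" for m unfolding I_def by simp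
  define Q where "Q = (\<lambda>m x. ennreal (1 / x * norm (T m x)) * indicator (I m) x)"
  have [measurable]: "Q m \<in> borel_measurable borel" for m unfolding Q_def by measurable
  have "2 * \<theta> = 0 \<or> 2 * \<theta> = pi" using \<theta> by auto
  then have sin2: "sin (2 * \<theta>) = 0" by (elim disjE) (simp_all only: sin_zero sin_pi)
  \<comment> \<open>\<open>17\<close> is the least integer whose square, \<open>289\<close>, is at
    least \<open>288\<close>.\<close>
  have level: "integral\<^sup>N lborel (Q m) \<le> ennreal (17 * N m)" for m
  proof (rule ennreal_le_if_square_le)
    define h :: real where "h = 2 powi m"
    have h: "0 < h" unfolding h_def by simp
    have gh: "integrable lborel (\<lambda>t. indicator {h..} t * g t)"
      by (rule Bochner_Integration.integrable_bound[OF g]) (auto simp: norm_mult indicator_def)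
    let ?a = "\<lambda>j. \<integral>\<^sup>+t. ennreal (norm (indicator {h..} t * g t)) * indicator {real j * h..<(real j + 1) * h} t \<partial>lborel"
    have "(integral\<^sup>N lborel (Q m))\<^sup>2 \<le> 288 * (\<Sum>j. (?a j)\<^sup>2)"
      using sine_transform_dyadic_bound[OF gh h _ sin2] g0
      unfolding Q_def T_def I_def h_def by simp
    also have "(\<Sum>j. (?a j)\<^sup>2) = (?a 0)\<^sup>2 + (\<Sum>j. (?a (Suc j))\<^sup>2)"
      using suminf_offset[of "\<lambda>j. (?a j)\<^sup>2" 1] by (simp add: add.commute)
    \<comment> \<open>Block \<open>0\<close> is \<open>[0, h)\<close>, which the cut-off at
      \<open>h\<close> removes; the remaining indices \<open>Suc j\<close> are exactly the blocks
      counted by the norm.\<close>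
    also have "?a 0 = 0"
      by (subst nn_integral_0_iff_AE) (auto simp: indicator_def)
    also have "(\<Sum>j. (?a (Suc j))\<^sup>2) \<le> (\<Sum>j. (\<integral>\<^sup>+t. ennreal (norm (g t)) *
        indicator {real (Suc j) * h..<(real (Suc j) + 1) * h} t \<partial>lborel)\<^sup>2)"
      by (intro suminf_le power_mono nn_integral_mono) (auto simp: indicator_def norm_mult)
    also have "\<dots> \<le> ennreal ((N m)\<^sup>2)" unfolding h_def by (rule blocks)
    finally have "(integral\<^sup>N lborel (Q m))\<^sup>2 \<le> 288 * ennreal ((N m)\<^sup>2)"
      by (simp add: mult_left_mono)
    also have "\<dots> = ennreal (288 * (N m)\<^sup>2)" by (simp add: ennreal_mult)
    also have "\<dots> \<le> ennreal ((17 * N m)\<^sup>2)"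
      by (intro ennreal_leI) (simp add: power_mult_distrib mult_right_mono)
    finally show "(integral\<^sup>N lborel (Q m))\<^sup>2 \<le> ennreal ((17 * N m)\<^sup>2)" .
  qed (use N0 in simp)
  have pw: "ennreal (1 / x * norm (\<integral>t. g t * remainder_weight \<theta> (x * t) \<partial>lborel)) * indicator {0<..} x
      \<le> P x * indicator {0<..} x + (\<Sum>n. Q (int_decode n) x)" for x
  proof (cases "0 < x")
    case True
    then obtain k :: int where k: "2 powi k \<le> x" "x < 2 * 2 powi k" using dyadic_interval_exists by blast
    \<comment> \<open>Frequencies in \<open>[2 powi k, 2 * 2 powi k)\<close> belong to the block
      length \<open>h = 2 powi (- k)\<close>, so the level is \<open>- k\<close>.\<close>
    have x: "x \<in> {1 / 2 powi (- k)..<2 / 2 powi (- k)}"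
      using k by (simp add: power_int_minus divide_inverse)
    have "ennreal (1 / x * norm (\<integral>t. g t * remainder_weight \<theta> (x * t) \<partial>lborel)) \<le> P x + Q (- k) x"
      using remainder_pointwise_bound[OF g g0 \<theta> _ x] x unfolding P_def Q_def T_def I_def by simp
    also have "Q (- k) x \<le> (\<Sum>n. Q (int_decode n) x)"
      using ennreal_le_suminf[of "\<lambda>n. Q (int_decode n) x" "int_encode (- k)"] by simp
    finally show ?thesis using True by (simp add: add_left_mono)
  qed simp
  have "(\<integral>\<^sup>+x. ennreal (1 / x * norm (\<integral>t. g t * remainder_weight \<theta> (x * t) \<partial>lborel)) * indicator {0<..} x \<partial>lborel)
      \<le> (\<integral>\<^sup>+x. P x * indicator {0<..} x + (\<Sum>n. Q (int_decode n) x) \<partial>lborel)"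
    by (intro nn_integral_mono pw)
  also have "\<dots> = (\<integral>\<^sup>+x. P x * indicator {0<..} x \<partial>lborel) + (\<integral>\<^sup>+x. (\<Sum>n. Q (int_decode n) x) \<partial>lborel)"
    by (rule nn_integral_add) measurable
  also have "(\<integral>\<^sup>+x. (\<Sum>n. Q (int_decode n) x) \<partial>lborel) = (\<Sum>n. integral\<^sup>N lborel (Q (int_decode n)))"
    by (rule nn_integral_suminf) measurable
  also have "\<dots> \<le> (\<Sum>n. ennreal (17 * N (int_decode n)))"
    by (intro suminf_le level) auto
  also have "\<dots> = ennreal (17 * S)"
  proof -
    have "(\<Sum>n. ennreal (17 * N (int_decode n))) = ennreal 17 * (\<Sum>n. ennreal (N (int_decode n)))"
      using N0 by (subst ennreal_suminf_cmult[symmetric]) (simp add: ennreal_mult)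
    also have "\<dots> = ennreal 17 * ennreal S"
      unfolding S_def using suminf_ennreal_int_decode[OF N N0] by simp
    finally show ?thesis using S0 by (simp add: ennreal_mult)
  qed
  also have "(\<integral>\<^sup>+x. P x * indicator {0<..} x \<partial>lborel) = 2 * (\<integral>\<^sup>+t. ennreal (norm (g t)) \<partial>lborel)"
    unfolding P_def by (rule nn_integral_hyperbola) (auto simp: g0)
  \<comment> \<open>The part with \<open>x * t < 2\<close> costs twice the \<open>L^1\<close> norm
    of \<open>g\<close> and the sine parts cost \<open>17\<close>; together they give the constant
    \<open>19\<close> of the theorem.\<close>
  also have "2 * (\<integral>\<^sup>+t. ennreal (norm (g t)) \<partial>lborel) + ennreal (17 * S) \<le> 2 * ennreal S + ennreal (17 * S)"
    using J unfolding S_def by (intro add_right_mono mult_left_mono) auto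
  also have "\<dots> = ennreal (19 * S)"
  proof -
    have "2 * ennreal S + ennreal (17 * S) = ennreal (2 * S) + ennreal (17 * S)"
      using S0 by (simp add: ennreal_mult)
    also have "\<dots> = ennreal (2 * S + 17 * S)"
      using S0 by (subst ennreal_plus) auto
    finally show ?thesis by simp
  qed
  finally show ?thesis unfolding S_def by (simp add: add_left_mono)
qed

subsection \<open>Fourier transforms of tail integrals\<close>

lemma cos_antiderivative_integral:
  fixes x r \<theta> :: real
  assumes "0 < x" "0 \<le> r"
  shows "(\<integral>t. indicator {0<..r} t * cos (x * t - \<theta>) \<partial>lborel) = (sin (x * r - \<theta>) + sin \<theta>) / x"
proof -
  have "has_bochner_integral lborel (\<lambda>t. indicator {0..r} t *\<^sub>R cos (x * t - \<theta>)) (sin (x * r - \<theta>) / x - sin (x * 0 - \<theta>) / x)"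
  proof (rule has_bochner_integral_FTC_Icc[OF assms(2)])
    fix t :: real
    show "((\<lambda>t. sin (x * t - \<theta>) / x) has_vector_derivative cos (x * t - \<theta>)) (at t within {0..r})"
      unfolding has_real_derivative_iff_has_vector_derivative[symmetric]
      using assms(1) by (auto intro!: derivative_eq_intros)
  qed (intro continuous_intros)
  then have "(\<integral>t. indicator {0..r} t * cos (x * t - \<theta>) \<partial>lborel) = (sin (x * r - \<theta>) + sin \<theta>) / x"
    by (simp add: has_bochner_integral_iff add_divide_distrib)
  moreover have "(\<integral>t. indicator {0<..r} t * cos (x * t - \<theta>) \<partial>lborel) = (\<integral>t. indicator {0..r} t * cos (x * t - \<theta>) \<partial>lborel)"
  proof (rule integral_cong_AE)
    show "AE t in lborel. indicator {0<..r} t * cos (x * t - \<theta>) = indicator {0..r} t * cos (x * t - \<theta>)"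
      using AE_lborel_singleton[of 0] by eventually_elim (auto simp: indicator_def)
  qed measurable
  ultimately show ?thesis by simp
qed

text \<open>On \<open>(0, M]\<close> the double integrand is dominated by an integrable product, so
  Fubini applies. On the whole half-line the cosine is not integrable, which is why the limit in
  \<open>M\<close> is taken only afterwards. For fixed \<open>s\<close> the variable
  \<open>t\<close> runs over \<open>(0, min s M]\<close>.\<close>

lemma tail_integral_transform:
  fixes g :: "real \<Rightarrow> complex" and f :: "real \<Rightarrow> complex" and x \<theta> :: real
  assumes g: "integrable lborel g" and g0: "\<And>s. s \<le> 0 \<Longrightarrow> g s = 0"
    and f: "\<And>t. 0 < t \<Longrightarrow> f t = - (\<integral>s. indicator {t..} s *\<^sub>R g s \<partial>lborel)" and x: "0 < x" and M: "0 < M"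
  shows "set_integrable lebesgue {0<..M} (\<lambda>t. f t * complex_of_real (cos (x * t - \<theta>)))" (is ?int)
    and "(LINT t:{0<..M}|lebesgue. f t * complex_of_real (cos (x * t - \<theta>)))
      = - (\<integral>s. g s * complex_of_real ((sin (x * min s M - \<theta>) + sin \<theta>) / x) \<partial>lborel)" (is ?eq)
proof -
  have [measurable]: "g \<in> borel_measurable borel" using g by auto
  define c where "c = (\<lambda>t. indicator {0<..M} t * cos (x * t - \<theta>) :: real)"
  have [measurable]: "c \<in> borel_measurable borel" unfolding c_def by measurable
  have c_int: "integrable lborel c"
  proof (rule Bochner_Integration.integrable_bound)
    show "integrable lborel (indicator {0<..M} :: real \<Rightarrow> real)" using M by simp
  qed (auto simp: c_def indicator_def)
  define k where "k = (\<lambda>t s. complex_of_real (c t) * (indicator {t..} s *\<^sub>R g s))"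
  \<comment> \<open>The indicator of a set that varies with \<open>t\<close> becomes a comparison of
    the two variables, which makes joint measurability evident.\<close>
  have k_alt: "k t s = complex_of_real (c t * of_bool (t \<le> s)) * g s" for t s
    by (auto simp: k_def indicator_def)
  have [measurable]: "case_prod k \<in> borel_measurable (borel \<Otimes>\<^sub>M borel)"
    unfolding k_alt by measurable
  have k_int: "integrable (lborel \<Otimes>\<^sub>M lborel) (case_prod k)"
  proof (rule Bochner_Integration.integrable_bound)
    show "integrable (lborel \<Otimes>\<^sub>M lborel) (\<lambda>(t, s). c t * norm (g s))"
      by (intro integrable_product_pair c_int integrable_norm g)
    show "AE p in lborel \<Otimes>\<^sub>M lborel. norm (case_prod k p) \<le> norm (case p of (t, s) \<Rightarrow> c t * norm (g s))"
      by (rule AE_I2) (auto simp: k_def norm_mult abs_mult indicator_def)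
  qed simp
  have eq: "indicator {0<..M} t *\<^sub>R (f t * complex_of_real (cos (x * t - \<theta>))) = - (\<integral>s. k t s \<partial>lborel)" for t
  proof (cases "t \<in> {0<..M}")
    case True
    have "(\<integral>s. k t s \<partial>lborel) = complex_of_real (c t) * (\<integral>s. indicator {t..} s *\<^sub>R g s \<partial>lborel)"
      unfolding k_def by (rule integral_mult_right_zero)
    then show ?thesis using f[of t] True by (simp add: c_def mult.commute)
  qed (simp add: k_def c_def)
  have [measurable]: "(\<lambda>t. \<integral>s. k t s \<partial>lborel) \<in> borel_measurable borel" by measurable
  have int': "integrable lborel (\<lambda>t. \<integral>s. k t s \<partial>lborel)"
    by (rule lborel_pair.integrable_fst[OF k_int])
  then show ?int
    unfolding set_integrable_def eq by (subst integrable_completion) auto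
  have "(LINT t:{0<..M}|lebesgue. f t * complex_of_real (cos (x * t - \<theta>))) = - (\<integral>t. \<integral>s. k t s \<partial>lborel \<partial>lborel)"
    unfolding set_lebesgue_integral_def eq by (subst integral_completion) auto
  also have "(\<integral>t. \<integral>s. k t s \<partial>lborel \<partial>lborel) = (\<integral>s. \<integral>t. k t s \<partial>lborel \<partial>lborel)"
    by (rule lborel_pair.Fubini_integral[OF k_int, symmetric])
  also have "\<dots> = (\<integral>s. g s * complex_of_real ((sin (x * min s M - \<theta>) + sin \<theta>) / x) \<partial>lborel)"
  proof (rule Bochner_Integration.integral_cong[OF refl])
    fix s
    show "(\<integral>t. k t s \<partial>lborel) = g s * complex_of_real ((sin (x * min s M - \<theta>) + sin \<theta>) / x)"
    proof (cases "s \<le> 0")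
      case True
      then show ?thesis by (simp add: k_alt g0)
    next
      case False
      have "(\<lambda>t. k t s) = (\<lambda>t. complex_of_real (indicator {0<..min s M} t * cos (x * t - \<theta>)) * g s)"
        by (auto simp: k_alt c_def indicator_def)
      then have "(\<integral>t. k t s \<partial>lborel) = complex_of_real (\<integral>t. indicator {0<..min s M} t * cos (x * t - \<theta>) \<partial>lborel) * g s"
        by (simp only: integral_mult_left_zero integral_complex_of_real)
      then show ?thesis
        using cos_antiderivative_integral[OF x, of "min s M" \<theta>] False M by simp
    qed
  qed
  finally show ?eq .
qed

text \<open>Dominated convergence: for fixed \<open>s\<close> the integrand no longer changes once
  \<open>M \<ge> s\<close>.\<close>

lemma tail_integral_transform_tendsto:
  fixes g :: "real \<Rightarrow> complex" and x \<theta> :: real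
  assumes g: "integrable lborel g" and x: "0 < x"
  shows "((\<lambda>M. \<integral>s. g s * complex_of_real ((sin (x * min s M - \<theta>) + sin \<theta>) / x) \<partial>lborel)
    \<longlongrightarrow> (\<integral>s. g s * complex_of_real ((sin (x * s - \<theta>) + sin \<theta>) / x) \<partial>lborel)) at_top"
proof (rule integral_dominated_convergence_at_top[where w = "\<lambda>s. norm (g s) * (2 / x)"])
  have [measurable]: "g \<in> borel_measurable borel" using g by auto
  show "(\<lambda>s. g s * complex_of_real ((sin (x * min s M - \<theta>) + sin \<theta>) / x)) \<in> borel_measurable lborel" for M
    by measurable
  show "(\<lambda>s. g s * complex_of_real ((sin (x * s - \<theta>) + sin \<theta>) / x)) \<in> borel_measurable lborel"
    by measurable
  show "integrable lborel (\<lambda>s. norm (g s) * (2 / x))" using g by simp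
  show "\<forall>\<^sub>F M in at_top. AE s in lborel. norm (g s * complex_of_real ((sin (x * min s M - \<theta>) + sin \<theta>) / x)) \<le> norm (g s) * (2 / x)"
  proof (intro always_eventually allI AE_I2)
    fix M s
    have "\<bar>sin (x * min s M - \<theta>) + sin \<theta>\<bar> \<le> 2"
      using abs_sin_le_one[of "x * min s M - \<theta>"] abs_sin_le_one[of \<theta>] by linarith
    then have "\<bar>(sin (x * min s M - \<theta>) + sin \<theta>) / x\<bar> \<le> 2 / x"
      using x by (simp add: divide_right_mono)
    then show "norm (g s * complex_of_real ((sin (x * min s M - \<theta>) + sin \<theta>) / x)) \<le> norm (g s) * (2 / x)"
      unfolding norm_mult norm_of_real by (rule mult_left_mono) simp
  qed
  show "AE s in lborel. ((\<lambda>M. g s * complex_of_real ((sin (x * min s M - \<theta>) + sin \<theta>) / x))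
      \<longlongrightarrow> g s * complex_of_real ((sin (x * s - \<theta>) + sin \<theta>) / x)) at_top"
  proof (rule AE_I2)
    fix s :: real
    have "\<forall>\<^sub>F M in at_top. s \<le> M" by (rule eventually_ge_at_top)
    then have "\<forall>\<^sub>F M in at_top. g s * complex_of_real ((sin (x * s - \<theta>) + sin \<theta>) / x)
      = g s * complex_of_real ((sin (x * min s M - \<theta>) + sin \<theta>) / x)"
      by eventually_elim (simp add: min_def)
    then show "((\<lambda>M. g s * complex_of_real ((sin (x * min s M - \<theta>) + sin \<theta>) / x))
      \<longlongrightarrow> g s * complex_of_real ((sin (x * s - \<theta>) + sin \<theta>) / x)) at_top"
      by (rule Lim_transform_eventually[OF tendsto_const])
  qed
qed

lemma fourier_transform_tail_integral:
  fixes g :: "real \<Rightarrow> complex" and f :: "real \<Rightarrow> complex" and x :: real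
  assumes g: "integrable lborel g" and g0: "\<And>s. s \<le> 0 \<Longrightarrow> g s = 0"
    and f: "\<And>t. 0 < t \<Longrightarrow> f t = - (\<integral>s. indicator {t..} s *\<^sub>R g s \<partial>lborel)" and x: "0 < x"
    and \<theta>: "\<theta> = pi * real \<gamma> / 2"
  shows "fourier_transform_exists \<gamma> f x"
    and "fourier_transform \<gamma> f x = complex_of_real (1 / x) * f (pi / (2 * x)) * complex_of_real (sin \<theta>)
      - complex_of_real (1 / x) * (\<integral>s. g s * remainder_weight \<theta> (x * s) \<partial>lborel)"
proof -
  have [measurable]: "g \<in> borel_measurable borel" using g by auto
  let ?L = "- (\<integral>s. g s * complex_of_real ((sin (x * s - \<theta>) + sin \<theta>) / x) \<partial>lborel)"
  have "((\<lambda>M. - (\<integral>s. g s * complex_of_real ((sin (x * min s M - \<theta>) + sin \<theta>) / x) \<partial>lborel)) \<longlongrightarrow> ?L) at_top"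
    by (intro tendsto_minus tail_integral_transform_tendsto[OF g x])
  moreover have "\<forall>\<^sub>F M in at_top. - (\<integral>s. g s * complex_of_real ((sin (x * min s M - \<theta>) + sin \<theta>) / x) \<partial>lborel)
      = truncated_transform \<gamma> f x M"
    using eventually_gt_at_top[of 0]
  proof eventually_elim
    case (elim M)
    show ?case
      unfolding truncated_transform_def \<theta>[symmetric]
      by (rule tail_integral_transform(2)[OF g g0 f x elim, symmetric])
  qed
  ultimately have lim: "(truncated_transform \<gamma> f x \<longlongrightarrow> ?L) at_top"
    by (rule Lim_transform_eventually)
  then show "fourier_transform_exists \<gamma> f x"
    unfolding fourier_transform_exists_def \<theta>[symmetric] using tail_integral_transform(1)[OF g g0 f x] by blast
  have "fourier_transform \<gamma> f x = ?L"
    unfolding fourier_transform_def by (rule tendsto_Lim[OF _ lim]) simp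
  also have "\<dots> = complex_of_real (1 / x) * f (pi / (2 * x)) * complex_of_real (sin \<theta>)
      - complex_of_real (1 / x) * (\<integral>s. g s * remainder_weight \<theta> (x * s) \<partial>lborel)"
  proof -
    let ?p = "pi / (2 * x)"
    have i1: "integrable lborel (\<lambda>s. g s * complex_of_real (remainder_weight \<theta> (x * s)))"
    proof (rule Bochner_Integration.integrable_bound)
      show "integrable lborel (\<lambda>s. 2 * g s)" using g by simp
      show "AE s in lborel. norm (g s * complex_of_real (remainder_weight \<theta> (x * s))) \<le> norm (2 * g s)"
      proof (rule AE_I2)
        fix s
        have "\<bar>remainder_weight \<theta> (x * s)\<bar> \<le> 2"
          unfolding remainder_weight_def
          by (rule order_trans[OF abs_triangle_ineq])
            (use add_mono[OF abs_sin_le_one[of "x * s - \<theta>"] abs_sin_le_one[of \<theta>]]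
              order_trans[OF abs_sin_le_one[of "x * s - \<theta>"], of 2] in auto)
        then have "norm (g s) * \<bar>remainder_weight \<theta> (x * s)\<bar> \<le> norm (g s) * 2" by (rule mult_left_mono) simp
        then show "norm (g s * complex_of_real (remainder_weight \<theta> (x * s))) \<le> norm (2 * g s)"
          by (simp add: norm_mult)
      qed
    qed measurable
    have i2: "integrable lborel (\<lambda>s. indicator {?p..} s *\<^sub>R g s)"
      using g by (intro integrable_mult_indicator) auto
    \<comment> \<open>The half-line \<open>s \<ge> ?p\<close> is exactly where the conditional
      summand of \<open>remainder_weight\<close> is switched off. There the constant
      \<open>sin \<theta>\<close> is left over, and its integral against \<open>g\<close> is the
      term with \<open>f (pi / (2 * x))\<close>.\<close>
    have p: "s \<in> {?p..} \<longleftrightarrow> \<not> x * s < pi / 2" for s using x by (auto simp: field_simps)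
    have "g s * complex_of_real ((sin (x * s - \<theta>) + sin \<theta>) / x) =
        complex_of_real (1 / x) * (g s * complex_of_real (remainder_weight \<theta> (x * s))) +
        complex_of_real (1 / x) * complex_of_real (sin \<theta>) * (indicator {?p..} s *\<^sub>R g s)" for s
      using p[of s] by (auto simp: remainder_weight_def indicator_def algebra_simps add_divide_distrib)
    then have "(\<integral>s. g s * complex_of_real ((sin (x * s - \<theta>) + sin \<theta>) / x) \<partial>lborel)
        = complex_of_real (1 / x) * (\<integral>s. g s * complex_of_real (remainder_weight \<theta> (x * s)) \<partial>lborel)
        + complex_of_real (1 / x) * complex_of_real (sin \<theta>) * (\<integral>s. indicator {?p..} s *\<^sub>R g s \<partial>lborel)"
      by (simp only: Bochner_Integration.integral_add[OF integrable_mult_right[OF i1] integrable_mult_right[OF i2]]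
          integral_mult_right_zero)
    moreover have "(\<integral>s. indicator {?p..} s *\<^sub>R g s \<partial>lborel) = - f ?p" using f[of ?p] x by simp
    ultimately show ?thesis by (simp add: algebra_simps)
  qed
  finally show "fourier_transform \<gamma> f x = complex_of_real (1 / x) * f (pi / (2 * x)) * complex_of_real (sin \<theta>)
      - complex_of_real (1 / x) * (\<integral>s. g s * remainder_weight \<theta> (x * s) \<partial>lborel)" .
qed

subsection \<open>Derivatives in A12\<close>

lemma lebesgue_measurable_complex_ex_borel:
  fixes u :: "real \<Rightarrow> complex"
  assumes "u \<in> borel_measurable lebesgue"
  obtains v where "v \<in> borel_measurable borel" "AE t in lborel. u t = v t"
proof -
  obtain a where a: "a \<in> borel_measurable lborel" "AE t in lborel. Re (u t) = a t"
    using completion_ex_borel_measurable_real[of "\<lambda>t. Re (u t)" lborel] assms by auto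
  obtain b where b: "b \<in> borel_measurable lborel" "AE t in lborel. Im (u t) = b t"
    using completion_ex_borel_measurable_real[of "\<lambda>t. Im (u t)" lborel] assms by auto
  show ?thesis
  proof
    have [measurable]: "a \<in> borel_measurable borel" "b \<in> borel_measurable borel" using a(1) b(1) by auto
    show "(\<lambda>t. complex_of_real (a t) + \<i> * complex_of_real (b t)) \<in> borel_measurable borel" by measurable
    show "AE t in lborel. u t = complex_of_real (a t) + \<i> * complex_of_real (b t)"
      using a(2) b(2) by eventually_elim (simp add: complex_eq_iff)
  qed
qed

text \<open>Local integrability gives only Lebesgue measurability, whereas the product-measure
  arguments run over \<open>lborel\<close>. A Borel representative on the half-line, extended by
  \<open>0\<close>, takes the place of the derivative there.\<close>

lemma locally_integrable_ex_borel:
  assumes D: "locally_integrable D"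
  obtains g where "g \<in> borel_measurable borel" "AE t in lborel. 0 < t \<longrightarrow> D t = g t" "\<And>t. t \<le> 0 \<Longrightarrow> g t = 0"
proof -
  define u where "u = (\<lambda>t. indicator {0<..} t *\<^sub>R D t)"
  have "u \<in> borel_measurable lebesgue"
  proof (rule borel_measurable_LIMSEQ_metric)
    fix n :: nat
    \<comment> \<open>\<open>locally_integrable\<close> asks for a nondegenerate interval; the right
      endpoint \<open>n + 2\<close> exceeds \<open>1 / (n + 1)\<close> even for
      \<open>n = 0\<close>.\<close>
    have "1 / real (Suc n) \<le> 1" by simp
    also have "1 < real (Suc (Suc n))" by simp
    finally have "set_integrable lebesgue {1 / real (Suc n)..real (Suc (Suc n))} D"
      using D unfolding locally_integrable_def by (metis of_nat_0_less_iff zero_less_Suc zero_less_divide_1_iff)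
    then show "(\<lambda>t. indicator {1 / real (Suc n)..real (Suc (Suc n))} t *\<^sub>R D t) \<in> borel_measurable lebesgue"
      unfolding set_integrable_def by (rule borel_measurable_integrable)
  next
    fix t :: real
    have "\<forall>\<^sub>F n in sequentially. u t = indicator {1 / real (Suc n)..real (Suc (Suc n))} t *\<^sub>R D t"
    proof (cases "0 < t")
      case True
      obtain n1 where n1: "1 / t < real n1" using reals_Archimedean2 by blast
      obtain n2 where n2: "t < real n2" using reals_Archimedean2 by blast
      show ?thesis
        using eventually_ge_at_top[of "max n1 n2"]
      proof eventually_elim
        case (elim n)
        then have "1 / t < real (Suc n)" "t \<le> real (Suc (Suc n))" using n1 n2 by auto
        then have "t \<in> {1 / real (Suc n)..real (Suc (Suc n))}"
          using True by (simp add: field_simps)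
        then show ?case using True by (simp add: u_def)
      qed
    next
      case False
      moreover have "0 < 1 / real (Suc n)" for n by simp
      ultimately have "t \<notin> {1 / real (Suc n)..real (Suc (Suc n))}" for n
        by (meson atLeastAtMost_iff less_le_trans)
      then show ?thesis using False by (simp add: u_def)
    qed
    then show "(\<lambda>n. indicator {1 / real (Suc n)..real (Suc (Suc n))} t *\<^sub>R D t) \<longlonglongrightarrow> u t"
      by (rule Lim_transform_eventually[OF tendsto_const])
  qed
  then obtain v where v: "v \<in> borel_measurable borel" "AE t in lborel. u t = v t"
    using lebesgue_measurable_complex_ex_borel by blast
  show ?thesis
  proof
    show "(\<lambda>t. indicator {0<..} t *\<^sub>R v t) \<in> borel_measurable borel" using v(1) by measurable
    show "AE t in lborel. 0 < t \<longrightarrow> D t = indicator {0<..} t *\<^sub>R v t"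
      using v(2) by eventually_elim (auto simp: u_def indicator_def)
  qed simp
qed

lemma dyadic_integral_eq_nn_integral:
  assumes D: "locally_integrable D" and g: "g \<in> borel_measurable borel" "AE t in lborel. 0 < t \<longrightarrow> D t = g t"
    and j: "1 \<le> j"
  shows "(\<integral>\<^sup>+t. ennreal (norm (g t)) * indicator {real j * 2 powi m..<(real j + 1) * 2 powi m} t \<partial>lborel)
    = ennreal (dyadic_integral D m j)"
proof -
  let ?a = "real j * 2 powi m" and ?b = "(real j + 1) * 2 powi m"
  have pos: "0 < ?a" using j by simp
  have "?a < ?b" by simp
  then have "set_integrable lebesgue {?a..?b} D"
    using D pos unfolding locally_integrable_def by blast
  then have "integrable lebesgue (\<lambda>t. norm (indicator {?a..?b} t *\<^sub>R D t))"
    unfolding set_integrable_def by (rule integrable_norm)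
  then have int: "integrable lebesgue (\<lambda>t. indicator {?a..?b} t *\<^sub>R norm (D t))" by simp
  have "ennreal (dyadic_integral D m j) = (\<integral>\<^sup>+t. ennreal (indicator {?a..?b} t *\<^sub>R norm (D t)) \<partial>lebesgue)"
    unfolding dyadic_integral_def set_lebesgue_integral_def
    by (rule nn_integral_eq_integral[OF int, symmetric]) simp
  also have "\<dots> = (\<integral>\<^sup>+t. ennreal (indicator {?a..?b} t *\<^sub>R norm (D t)) \<partial>lborel)"
    by (rule nn_integral_completion)
  \<comment> \<open>Closed and half-open blocks differ by one point, and \<open>j \<ge> 1\<close>
    keeps the block in the positive axis, where \<open>D\<close> and \<open>g\<close> agree almost
    everywhere.\<close>
  also have "\<dots> = (\<integral>\<^sup>+t. ennreal (norm (g t)) * indicator {?a..<?b} t \<partial>lborel)"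
    using g(2) AE_lborel_singleton[of ?b]
    by (intro nn_integral_cong_AE, eventually_elim) (use pos in \<open>auto simp: indicator_def\<close>)
  finally show ?thesis by simp
qed

lemma A12_blocks:
  assumes D: "D \<in> A12" and g: "g \<in> borel_measurable borel" "AE t in lborel. 0 < t \<longrightarrow> D t = g t"
  defines "N \<equiv> \<lambda>m. sqrt (\<Sum>\<^sub>\<infinity>j\<in>{1..}. (dyadic_integral D m j)\<^sup>2)"
  shows "(\<Sum>j. (\<integral>\<^sup>+t. ennreal (norm (g t)) *
        indicator {real (Suc j) * 2 powi m..<(real (Suc j) + 1) * 2 powi m} t \<partial>lborel)\<^sup>2) = ennreal ((N m)\<^sup>2)"
proof -
  have loc: "locally_integrable D" and sm: "(\<lambda>j. (dyadic_integral D m j)\<^sup>2) summable_on {1..}"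
    using D by (auto simp: A12_def)
  have nn: "0 \<le> dyadic_integral D m j" for j
    unfolding dyadic_integral_def set_lebesgue_integral_def by (rule integral_nonneg_AE) simp
  have "((\<lambda>j. (dyadic_integral D m j)\<^sup>2) has_sum (N m)\<^sup>2) {1..}"
    using sm unfolding N_def by (simp add: infsum_nonneg)
  moreover have "bij_betw Suc UNIV {1..}"
    by (rule bij_betwI[where g = "\<lambda>n. n - 1"]) auto
  ultimately have "((\<lambda>j. (dyadic_integral D m (Suc j))\<^sup>2) has_sum (N m)\<^sup>2) UNIV"
    using has_sum_reindex_bij_betw[of Suc UNIV "{1..}" "\<lambda>j. (dyadic_integral D m j)\<^sup>2"] by simp
  then have "(\<lambda>j. (dyadic_integral D m (Suc j))\<^sup>2) sums (N m)\<^sup>2" by (rule has_sum_imp_sums)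
  then have "(\<Sum>j. ennreal ((dyadic_integral D m (Suc j))\<^sup>2)) = ennreal ((N m)\<^sup>2)"
    by (simp add: suminf_ennreal2 sums_iff)
  moreover have "(\<integral>\<^sup>+t. ennreal (norm (g t)) *
        indicator {real (Suc j) * 2 powi m..<(real (Suc j) + 1) * 2 powi m} t \<partial>lborel)\<^sup>2
      = ennreal ((dyadic_integral D m (Suc j))\<^sup>2)" for j
    using dyadic_integral_eq_nn_integral[OF loc g, of "Suc j" m] nn by (simp add: ennreal_power)
  ultimately show ?thesis by simp
qed

text \<open>The dyadic interval \<open>[2 powi m, 2 * 2 powi m)\<close> is the block
  \<open>j = 1\<close> of level \<open>m\<close>, so its mass is one of the terms under the square
  root at that level. Summing over \<open>m\<close> covers the half-line.\<close>

lemma A12_L1_bound: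
  assumes D: "D \<in> A12" and g: "g \<in> borel_measurable borel" "AE t in lborel. 0 < t \<longrightarrow> D t = g t"
    and g0: "\<And>t. t \<le> 0 \<Longrightarrow> g t = 0"
  shows "(\<integral>\<^sup>+t. ennreal (norm (g t)) \<partial>lborel) \<le> ennreal (A12_norm D)"
proof -
  define N where "N = (\<lambda>m. sqrt (\<Sum>\<^sub>\<infinity>j\<in>{1..}. (dyadic_integral D m j)\<^sup>2))"
  have N0: "0 \<le> N m" for m unfolding N_def by (simp add: infsum_nonneg)
  have N: "N summable_on UNIV" using D unfolding A12_def N_def by auto
  have [measurable]: "g \<in> borel_measurable borel" by (rule g(1))
  have first: "(\<integral>\<^sup>+t. ennreal (norm (g t)) * indicator {2 powi m..<2 * 2 powi m} t \<partial>lborel) \<le> ennreal (N m)" for m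
  proof (rule ennreal_le_if_square_le[OF _ N0])
    show "(\<integral>\<^sup>+t. ennreal (norm (g t)) * indicator {2 powi m..<2 * 2 powi m} t \<partial>lborel)\<^sup>2 \<le> ennreal ((N m)\<^sup>2)"
      using ennreal_le_suminf[of "\<lambda>j. (\<integral>\<^sup>+t. ennreal (norm (g t)) *
        indicator {real (Suc j) * 2 powi m..<(real (Suc j) + 1) * 2 powi m} t \<partial>lborel)\<^sup>2" 0]
      unfolding A12_blocks[OF D g] N_def by simp
  qed
  have "(\<integral>\<^sup>+t. ennreal (norm (g t)) \<partial>lborel) = (\<integral>\<^sup>+t. ennreal (norm (g t)) * indicator {0<..} t \<partial>lborel)"
    using g0 by (intro nn_integral_cong) (auto simp: indicator_def)
  also have "\<dots> \<le> (\<Sum>n. \<integral>\<^sup>+t. ennreal (norm (g t)) * indicator {2 powi (int_decode n)..<2 * 2 powi (int_decode n)} t \<partial>lborel)"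
    using nn_integral_dyadic_le[of "\<lambda>t. ennreal (norm (g t))" id] by simp
  also have "\<dots> \<le> (\<Sum>n. ennreal (N (int_decode n)))"
    by (intro suminf_le first) auto
  also have "\<dots> = ennreal (A12_norm D)"
    using suminf_ennreal_int_decode[OF N N0] by (simp add: A12_norm_def N_def)
  finally show ?thesis .
qed

text \<open>The increment \<open>f y - f t\<close> is the integral of \<open>g\<close> over
  \<open>[t, y]\<close>, and \<open>y\<close> is sent to infinity. Local integrability turns the
  gauge integral of the fundamental theorem into a Lebesgue integral.\<close>

lemma tail_integral_representation:
  assumes f: "locally_abs_continuous f" and lim: "(f \<longlongrightarrow> 0) at_top" and D: "locally_integrable (derivative f)"
    and g: "integrable lborel g" "AE t in lborel. 0 < t \<longrightarrow> derivative f t = g t" and t: "0 < t"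
  shows "f t = - (\<integral>s. indicator {t..} s *\<^sub>R g s \<partial>lborel)"
proof -
  have [measurable]: "g \<in> borel_measurable borel" using g(1) by auto
  have fin: "(\<integral>s. indicator {..y} s *\<^sub>R (indicator {t..} s *\<^sub>R g s) \<partial>lborel) = f y - f t" if "t < y" for y
  proof -
    have si: "set_integrable lebesgue {t..y} (derivative f)"
      using D t that unfolding locally_integrable_def by blast
    have "f y - f t = integral {t..y} (derivative f)"
      using locally_abs_continuous_has_integral[OF f t, of y] that by (simp add: integral_unique)
    also have "\<dots> = (LINT s:{t..y}|lebesgue. derivative f s)"
      by (rule set_lebesgue_integral_eq_integral(2)[OF si, symmetric])
    also have "\<dots> = (\<integral>s. indicator {..y} s *\<^sub>R (indicator {t..} s *\<^sub>R g s) \<partial>lebesgue)"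
      unfolding set_lebesgue_integral_def
    proof (rule integral_cong_AE)
      show "(\<lambda>s. indicator {t..y} s *\<^sub>R derivative f s) \<in> borel_measurable lebesgue"
        using si unfolding set_integrable_def by (rule borel_measurable_integrable)
      show "(\<lambda>s. indicator {..y} s *\<^sub>R (indicator {t..} s *\<^sub>R g s)) \<in> borel_measurable lebesgue"
        by (rule measurable_completion) measurable
      show "AE s in lebesgue. indicator {t..y} s *\<^sub>R derivative f s = indicator {..y} s *\<^sub>R (indicator {t..} s *\<^sub>R g s)"
        using AE_completion[OF g(2)] by eventually_elim (use t in \<open>auto simp: indicator_def\<close>)
    qed
    also have "\<dots> = (\<integral>s. indicator {..y} s *\<^sub>R (indicator {t..} s *\<^sub>R g s) \<partial>lborel)"
      by (rule integral_completion) measurable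
    finally show ?thesis by simp
  qed
  have "integrable lborel (\<lambda>s. indicator {t..} s *\<^sub>R g s)"
    using g(1) by (intro integrable_mult_indicator) auto
  then have "((\<lambda>y. \<integral>s. indicator {..y} s *\<^sub>R (indicator {t..} s *\<^sub>R g s) \<partial>lborel)
      \<longlongrightarrow> (\<integral>s. indicator {t..} s *\<^sub>R g s \<partial>lborel)) at_top"
    by (intro tendsto_integral_at_top) simp
  moreover have "\<forall>\<^sub>F y in at_top. (\<integral>s. indicator {..y} s *\<^sub>R (indicator {t..} s *\<^sub>R g s) \<partial>lborel) = f y - f t"
    using eventually_gt_at_top[of t] by eventually_elim (rule fin)
  ultimately have "((\<lambda>y. f y - f t) \<longlongrightarrow> (\<integral>s. indicator {t..} s *\<^sub>R g s \<partial>lborel)) at_top"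
    by (rule Lim_transform_eventually)
  moreover have "((\<lambda>y. f y - f t) \<longlongrightarrow> 0 - f t) at_top"
    by (intro tendsto_diff lim tendsto_const)
  ultimately have "(\<integral>s. indicator {t..} s *\<^sub>R g s \<partial>lborel) = 0 - f t"
    by (intro tendsto_unique[of at_top]) auto
  then show ?thesis by simp
qed

section \<open>Assembly of the decomposition and its bound\<close>

theorem theorem2:
  shows "\<exists>C>0. \<forall>\<gamma>\<in>{0, 1}. \<forall>f :: real \<Rightarrow> complex.
    locally_abs_continuous f \<and> (f \<longlongrightarrow> 0) at_top \<and> derivative f \<in> A12 \<longrightarrow>
    (\<exists>\<Gamma> :: real \<Rightarrow> complex.
       (\<forall>x>0. fourier_transform_exists \<gamma> f x \<and>
          fourier_transform \<gamma> f x =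
            complex_of_real (1 / x) * f (pi / (2 * x)) * complex_of_real (sin (pi * real \<gamma> / 2)) + \<Gamma> x) \<and>
       set_integrable lebesgue {0<..} \<Gamma> \<and>
       (LINT x:{0<..}|lebesgue. norm (\<Gamma> x)) \<le> C * A12_norm (derivative f))"
proof (intro exI[of _ "19::real"] conjI ballI allI impI)
  fix \<gamma> :: nat and f :: "real \<Rightarrow> complex"
  assume \<gamma>: "\<gamma> \<in> {0, 1}"
    and "locally_abs_continuous f \<and> (f \<longlongrightarrow> 0) at_top \<and> derivative f \<in> A12"
  then have f: "locally_abs_continuous f" and lim: "(f \<longlongrightarrow> 0) at_top" and D: "derivative f \<in> A12"
    by auto
  have loc: "locally_integrable (derivative f)" using D by (simp add: A12_def)
  define \<theta> where "\<theta> = pi * real \<gamma> / 2"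
  have \<theta>: "\<theta> = 0 \<or> \<theta> = pi / 2" using \<gamma> by (auto simp: \<theta>_def)
  obtain g where gm [measurable]: "g \<in> borel_measurable borel"
    and gD: "AE t in lborel. 0 < t \<longrightarrow> derivative f t = g t" and g0: "\<And>t. t \<le> 0 \<Longrightarrow> g t = 0"
    using locally_integrable_ex_borel[OF loc] by blast
  have L1: "(\<integral>\<^sup>+t. ennreal (norm (g t)) \<partial>lborel) \<le> ennreal (A12_norm (derivative f))"
    by (rule A12_L1_bound[OF D gm gD g0])
  then have g: "integrable lborel g"
    by (intro integrableI_bounded) (auto intro: le_less_trans)
  note rep = tail_integral_representation[OF f lim loc g gD]
  define N where "N = (\<lambda>m. sqrt (\<Sum>\<^sub>\<infinity>j\<in>{1..}. (dyadic_integral (derivative f) m j)\<^sup>2))"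
  have N0: "0 \<le> N m" for m unfolding N_def by (simp add: infsum_nonneg)
  have N: "N summable_on UNIV" using D unfolding A12_def N_def by auto
  have norm_eq: "A12_norm (derivative f) = (\<Sum>\<^sub>\<infinity>m. N m)" unfolding A12_norm_def N_def ..
  \<comment> \<open>Built from the Borel representative \<open>g\<close>, so that measurability is
    immediate; the sign is that of the tail integral \<open>rep\<close>.\<close>
  define \<Gamma> where "\<Gamma> = (\<lambda>x. - (complex_of_real (1 / x) * (\<integral>s. g s * remainder_weight \<theta> (x * s) \<partial>lborel)))"
  have [measurable]: "\<Gamma> \<in> borel_measurable borel" unfolding \<Gamma>_def by measurable
  have "(\<integral>\<^sup>+x. ennreal (norm (indicator {0<..} x *\<^sub>R \<Gamma> x)) \<partial>lborel)
      = (\<integral>\<^sup>+x. ennreal (1 / x * norm (\<integral>t. g t * remainder_weight \<theta> (x * t) \<partial>lborel)) * indicator {0<..} x \<partial>lborel)"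
    by (intro nn_integral_cong) (auto simp: \<Gamma>_def indicator_def norm_mult norm_divide)
  also have "\<dots> \<le> ennreal (19 * (\<Sum>\<^sub>\<infinity>m. N m))"
  proof (rule remainder_integral_bound[OF g g0 \<theta> N0 N])
    show "(\<Sum>j. (\<integral>\<^sup>+t. ennreal (norm (g t)) *
        indicator {real (Suc j) * 2 powi m..<(real (Suc j) + 1) * 2 powi m} t \<partial>lborel)\<^sup>2) \<le> ennreal ((N m)\<^sup>2)" for m
      unfolding A12_blocks[OF D gm gD] N_def by simp
    show "(\<integral>\<^sup>+t. ennreal (norm (g t)) \<partial>lborel) \<le> ennreal (\<Sum>\<^sub>\<infinity>m. N m)"
      using L1 unfolding norm_eq .
  qed
  finally have bound: "(\<integral>\<^sup>+x. ennreal (norm (indicator {0<..} x *\<^sub>R \<Gamma> x)) \<partial>lborel) \<le> ennreal (19 * A12_norm (derivative f))"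
    unfolding norm_eq .
  have int: "integrable lborel (\<lambda>x. indicator {0<..} x *\<^sub>R \<Gamma> x)"
    using bound by (intro integrableI_bounded) (auto intro: le_less_trans)
  show "\<exists>\<Gamma> :: real \<Rightarrow> complex.
       (\<forall>x>0. fourier_transform_exists \<gamma> f x \<and>
          fourier_transform \<gamma> f x =
            complex_of_real (1 / x) * f (pi / (2 * x)) * complex_of_real (sin (pi * real \<gamma> / 2)) + \<Gamma> x) \<and>
       set_integrable lebesgue {0<..} \<Gamma> \<and>
       (LINT x:{0<..}|lebesgue. norm (\<Gamma> x)) \<le> 19 * A12_norm (derivative f)"
  proof (intro exI[of _ \<Gamma>] conjI allI impI)
    fix x :: real assume x: "0 < x"
    show "fourier_transform_exists \<gamma> f x"
      by (rule fourier_transform_tail_integral(1)[OF g g0 rep x \<theta>_def])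
    show "fourier_transform \<gamma> f x =
            complex_of_real (1 / x) * f (pi / (2 * x)) * complex_of_real (sin (pi * real \<gamma> / 2)) + \<Gamma> x"
      using fourier_transform_tail_integral(2)[OF g g0 rep x \<theta>_def] by (simp add: \<Gamma>_def \<theta>_def)
  next
    show "set_integrable lebesgue {0<..} \<Gamma>"
      unfolding set_integrable_def using int by (subst integrable_completion) auto
    have "(LINT x:{0<..}|lebesgue. norm (\<Gamma> x)) = (\<integral>x. norm (indicator {0<..} x *\<^sub>R \<Gamma> x) \<partial>lborel)"
      unfolding set_lebesgue_integral_def by (subst integral_completion) auto
    also have "ennreal (\<integral>x. norm (indicator {0<..} x *\<^sub>R \<Gamma> x) \<partial>lborel)
        = (\<integral>\<^sup>+x. ennreal (norm (indicator {0<..} x *\<^sub>R \<Gamma> x)) \<partial>lborel)"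
      using int by (intro nn_integral_eq_integral[symmetric] integrable_norm) auto
    finally have "ennreal (LINT x:{0<..}|lebesgue. norm (\<Gamma> x)) \<le> ennreal (19 * A12_norm (derivative f))"
      using bound by simp
    \<comment> \<open>\<open>ennreal\<close> sends negative reals to \<open>0\<close>, so the return
      to a real inequality needs a nonnegative right side.\<close>
    moreover have "0 \<le> 19 * A12_norm (derivative f)"
      unfolding norm_eq using infsum_nonneg[of UNIV N] N0 by simp
    ultimately show "(LINT x:{0<..}|lebesgue. norm (\<Gamma> x)) \<le> 19 * A12_norm (derivative f)"
      by (simp add: ennreal_le_iff)
  qed
qed simp

end
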